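(* Let $n\geq 2$ and let $\Omega$ be a bounded domain in $\mathbb{R}^n$ with $C^2$ boundary. Suppose there is a solution $u\in C^2(\overline{\Omega})$ of $$\Delta u=-1 \ \text{in } \Omega,\qquad u=0 \ \text{on } \partial\Omega,\qquad \frac{\partial u}{\partial\nu}=c|x| \ \text{on } \partial\Omega,$$ where $c$ is a constant. Then $\Omega$ is a ball centered at the origin, $c=-\frac1n$, and $$u(x)=-\frac{1}{2n}\left(|x|^2-R^2\right),$$ where $R$ is the radius of $\Omega$.
   Context: $\nu$ is the outward unit normal of $\partial\Omega$ and $|x|$ is the Euclidean norm of the position vector $x$. *)

theory Defs
  imports "HOL-Analysis.Analysis"
begin

definition C2_on_with ::
  "'a::euclidean_space set \<Rightarrow> ('a \<Rightarrow> real) \<Rightarrow> ('a \<Rightarrow> 'a) \<Rightarrow> ('a \<Rightarrow> 'a \<Rightarrow> 'a) \<Rightarrow> bool" where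
  "C2_on_with S f g H \<longleftrightarrow> open S \<and>
     (\<forall>x\<in>S. (f has_derivative (\<lambda>h. g x \<bullet> h)) (at x)) \<and>
     (\<forall>x\<in>S. (g has_derivative H x) (at x)) \<and>
     (\<forall>i\<in>Basis. \<forall>j\<in>Basis. continuous_on S (\<lambda>x. H x i \<bullet> j))"

definition C2_closure_with ::
  "'a::euclidean_space set \<Rightarrow> ('a \<Rightarrow> real) \<Rightarrow> ('a \<Rightarrow> 'a) \<Rightarrow> ('a \<Rightarrow> 'a \<Rightarrow> 'a) \<Rightarrow> bool" where
  "C2_closure_with \<Omega> u g H \<longleftrightarrow> C2_on_with \<Omega> u g H \<and>
     continuous_on (closure \<Omega>) u \<and> continuous_on (closure \<Omega>) g \<and>
     (\<forall>i\<in>Basis. \<forall>j\<in>Basis. \<exists>h. continuous_on (closure \<Omega>) h \<and> (\<forall>x\<in>\<Omega>. h x = H x i \<bullet> j))"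

definition laplacian_of :: "('a::euclidean_space \<Rightarrow> 'a \<Rightarrow> 'a) \<Rightarrow> 'a \<Rightarrow> real" where
  "laplacian_of H x = (\<Sum>i\<in>Basis. H x i \<bullet> i)"

definition boundary_chart ::
  "'a::euclidean_space set \<Rightarrow> 'a \<Rightarrow> real \<Rightarrow> ('a \<Rightarrow> real) \<Rightarrow> ('a \<Rightarrow> 'a) \<Rightarrow> bool" where
  "boundary_chart \<Omega> p r \<phi> d\<phi> \<longleftrightarrow> r > 0 \<and>
     (\<exists>H. C2_on_with (ball p r) \<phi> d\<phi> H) \<and>
     (\<forall>x\<in>ball p r. d\<phi> x \<noteq> 0) \<and>
     \<Omega> \<inter> ball p r = {x\<in>ball p r. \<phi> x < 0}"

definition C2_boundary :: "'a::euclidean_space set \<Rightarrow> bool" where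
  "C2_boundary \<Omega> \<longleftrightarrow> (\<forall>p\<in>frontier \<Omega>. \<exists>r \<phi> d\<phi>. boundary_chart \<Omega> p r \<phi> d\<phi>)"

text \<open>Outward unit normal at a boundary point (independent of the chart).\<close>
definition outward_normal :: "'a::euclidean_space set \<Rightarrow> 'a \<Rightarrow> 'a" where
  "outward_normal \<Omega> p = (SOME \<nu>. \<exists>r \<phi> d\<phi>. boundary_chart \<Omega> p r \<phi> d\<phi> \<and>
       \<nu> = d\<phi> p /\<^sub>R norm (d\<phi> p))"

definition bounded_domain :: "'a::euclidean_space set \<Rightarrow> bool" where
  "bounded_domain \<Omega> \<longleftrightarrow> open \<Omega> \<and> connected \<Omega> \<and> \<Omega> \<noteq> {} \<and> bounded \<Omega>"

end

theory Submission
  imports Defs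
begin

text \<open>
  Weinberger's argument. Put \<open>h = |\<nabla>u|\<^sup>2 - c\<^sup>2|x|\<^sup>2\<close>, which vanishes on the boundary. Comparing \<open>n|\<Omega>| = \<integral> x\<cdot>\<nu>\<close>
  with \<open>|\<Omega>| = -c \<integral> |x|\<close> gives \<open>n|c| \<le> 1\<close>, so \<open>h\<close> is subharmonic and hence \<open>h \<le> 0\<close>; a Pohozaev identity gives
  \<open>\<integral> h = 0\<close>. So \<open>|\<nabla>u| = |c||x|\<close> throughout: the maximum of \<open>u\<close> sits at the origin, linearising there gives
  \<open>n|c| \<ge> 1\<close>, and then the divergence-free field \<open>n\<nabla>u + x\<close>, whose product with \<open>\<nabla>u\<close> is nonnegative, must be 0.

  No surface integrals are used. A boundary integral \<open>\<integral> X\<cdot>\<nu>\<close> is replaced by \<open>-\<integral> \<psi>'(u) \<nabla>u\<cdot>X = \<integral> \<psi>(u) div X\<close>, where \<open>\<psi>\<close>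
  rises from 0 to 1 on \<open>[\<epsilon>, 2\<epsilon>]\<close>; the choice \<open>X = \<nabla>u\<close> shows that \<open>\<psi>'(u)|\<nabla>u|\<^sup>2\<close> has mass at most \<open>|\<Omega>|\<close>, so only
  pointwise information near the boundary is ever needed. As \<open>u\<close> is merely \<open>C\<^sup>2\<close>, subharmonicity of \<open>h\<close> is
  exploited through difference quotients.
\<close>

section \<open>Second derivatives and integrals of derivatives\<close>

lemma has_real_derivative_along_line:
  fixes f :: "'a::euclidean_space \<Rightarrow> real"
  assumes "(f has_derivative (\<lambda>h. G \<bullet> h)) (at (y + t *\<^sub>R e))"
  shows "((\<lambda>t. f (y + t *\<^sub>R e)) has_real_derivative G \<bullet> e) (at t within T)"
proof -
  have "((\<lambda>t. y + t *\<^sub>R e) has_derivative (\<lambda>s. s *\<^sub>R e)) (at t within T)"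
    by (auto intro!: derivative_eq_intros)
  from has_derivative_compose[OF this assms] show ?thesis
    by (simp add: has_field_derivative_def mult_commute_abs)
qed

lemma gradient_mean_value:
  fixes f :: "'a::euclidean_space \<Rightarrow> real"
  assumes "t > 0" "continuous_on {0..t} (\<lambda>s. f (y + s *\<^sub>R e))"
    and "\<And>s. 0 < s \<Longrightarrow> s < t \<Longrightarrow> (f has_derivative (\<lambda>h. G (y + s *\<^sub>R e) \<bullet> h)) (at (y + s *\<^sub>R e))"
  shows "\<exists>s. 0 < s \<and> s < t \<and> f (y + t *\<^sub>R e) - f y = t * (G (y + s *\<^sub>R e) \<bullet> e)"
proof -
  have "\<exists>s. 0 < s \<and> s < t \<and> f (y + t *\<^sub>R e) - f (y + 0 *\<^sub>R e) = G (y + s *\<^sub>R e) \<bullet> e * (t - 0)"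
    using mvt[of 0 t "\<lambda>s. f (y + s *\<^sub>R e)" "\<lambda>s x. G (y + s *\<^sub>R e) \<bullet> e * x"] assms
      has_real_derivative_along_line[OF assms(3)]
    unfolding has_field_derivative_def by (metis greaterThanLessThan_iff)
  then show ?thesis by (simp add: mult.commute)
qed

lemma line_in_open:
  fixes y e :: "'a::euclidean_space"
  assumes "open S" "y \<in> S"
  obtains d where "d > 0" "\<And>t. \<bar>t\<bar> < d \<Longrightarrow> y + t *\<^sub>R e \<in> S"
proof -
  obtain r where r: "r > 0" "ball y r \<subseteq> S" using assms openE by blast
  show thesis
  proof (rule that[of "r / (norm e + 1)"])
    show "r / (norm e + 1) > 0" using r by (simp add: add_nonneg_pos)
    fix t :: real assume "\<bar>t\<bar> < r / (norm e + 1)"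
    then have "\<bar>t\<bar> * (norm e + 1) < r" by (simp add: pos_less_divide_eq add_nonneg_pos)
    then have "\<bar>t\<bar> * norm e < r" by (smt (verit) mult_left_mono abs_ge_zero)
    then show "y + t *\<^sub>R e \<in> S" using r by (auto simp: dist_norm)
  qed
qed

text \<open>Since the gradient vanishes at \<open>y\<close>, a positive
  \<open>H e \<bullet> e\<close> would make the derivative of \<open>f\<close> along
  \<open>e\<close> positive just beyond \<open>y\<close>, and the mean value theorem would lift
  \<open>f\<close> above its maximum. Only differentiability of \<open>G\<close> at the point
  \<open>y\<close> enters.\<close>

lemma second_derivative_nonpos_at_max:
  fixes f :: "'a::euclidean_space \<Rightarrow> real"
  assumes S: "open S" "y \<in> S" and max: "\<And>x. x \<in> S \<Longrightarrow> f x \<le> f y"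
    and f: "\<And>x. x \<in> S \<Longrightarrow> (f has_derivative (\<lambda>h. G x \<bullet> h)) (at x)"
    and G: "(G has_derivative H) (at y)"
  shows "H e \<bullet> e \<le> 0"
proof (rule ccontr)
  assume "\<not> H e \<bullet> e \<le> 0"
  obtain d where d: "d > 0" "\<And>t. \<bar>t\<bar> < d \<Longrightarrow> y + t *\<^sub>R e \<in> S"
    using line_in_open[OF S, where e = e] by metis
  have "(\<lambda>h. G y \<bullet> h) = (\<lambda>h. 0)"
    using differential_zero_maxmin[OF S(2,1) f[OF S(2)]] max by blast
  then have G0: "G y \<bullet> e = 0" by metis
  have "((\<lambda>t. y + t *\<^sub>R e) has_derivative (\<lambda>s. s *\<^sub>R e)) (at 0)"
    by (auto intro!: derivative_eq_intros)
  from has_derivative_compose[OF this, of G H] G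
  have "((\<lambda>t. G (y + t *\<^sub>R e)) has_derivative (\<lambda>s. H (s *\<^sub>R e))) (at 0)" by simp
  then have "((\<lambda>t. G (y + t *\<^sub>R e) \<bullet> e) has_derivative (\<lambda>s. H (s *\<^sub>R e) \<bullet> e)) (at 0)"
    by (auto intro!: derivative_eq_intros)
  moreover have "H (s *\<^sub>R e) \<bullet> e = (H e \<bullet> e) * s" for s
    using linear_cmul[OF has_derivative_linear[OF G]] by simp
  ultimately have "((\<lambda>t. G (y + t *\<^sub>R e) \<bullet> e) has_real_derivative H e \<bullet> e) (at 0)"
    by (simp add: has_field_derivative_def)
  from DERIV_pos_inc_right[OF this] \<open>\<not> H e \<bullet> e \<le> 0\<close> G0
  obtain d' where d': "d' > 0" "\<And>t. 0 < t \<Longrightarrow> t < d' \<Longrightarrow> 0 < G (y + t *\<^sub>R e) \<bullet> e"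
    by auto
  define t where "t = min d d' / 2"
  have t: "0 < t" "t < d" "t < d'" using d(1) d'(1) by (auto simp: t_def)
  have fd: "(f has_derivative (\<lambda>h. G (y + s *\<^sub>R e) \<bullet> h)) (at (y + s *\<^sub>R e))" if "\<bar>s\<bar> < d" for s
    using f d(2) that by blast
  have "continuous_on {0..t} (\<lambda>s. f (y + s *\<^sub>R e))"
    by (rule DERIV_continuous_on, rule has_real_derivative_along_line[OF fd]) (use t in auto)
  then have "\<exists>s. 0 < s \<and> s < t \<and> f (y + t *\<^sub>R e) - f y = t * (G (y + s *\<^sub>R e) \<bullet> e)"
    by (rule gradient_mean_value[OF t(1)]) (use fd t in auto)
  then obtain s where
    s: "0 < s" "s < t" "f (y + t *\<^sub>R e) - f y = t * (G (y + s *\<^sub>R e) \<bullet> e)" by blast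
  then have "f (y + t *\<^sub>R e) > f y" using d' t by (smt (verit) mult_pos_pos)
  then show False using max d(2)[of t] t by force
qed

lemma laplacian_nonpos_at_max:
  fixes f :: "'a::euclidean_space \<Rightarrow> real"
  assumes "open S" "y \<in> S" "\<And>x. x \<in> S \<Longrightarrow> f x \<le> f y"
    and "\<And>x. x \<in> S \<Longrightarrow> (f has_derivative (\<lambda>h. G x \<bullet> h)) (at x)"
    and "(G has_derivative H y) (at y)"
  shows "laplacian_of H y \<le> 0"
  unfolding laplacian_of_def
  by (intro sum_nonpos second_derivative_nonpos_at_max[OF assms])

text \<open>The second difference of \<open>f\<close> over the parallelogram spanned by
  \<open>t *\<^sub>R a\<close> and \<open>t *\<^sub>R b\<close> is symmetric in \<open>a\<close> and
  \<open>b\<close>. Divided by \<open>t\<^sup>2\<close> it is within a multiple of \<eta> of either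
  side, and differentiability of \<open>g\<close> at \<open>x\<close> alone controls this
  error.\<close>

lemma second_derivative_symmetric:
  fixes f :: "'a::euclidean_space \<Rightarrow> real"
  assumes S: "open S" "x \<in> S"
    and f: "\<And>y. y \<in> S \<Longrightarrow> (f has_derivative (\<lambda>h. g y \<bullet> h)) (at y)"
    and g: "(g has_derivative H) (at x)"
  shows "H a \<bullet> b = H b \<bullet> a"
proof -
  obtain r where r: "r > 0" "ball x r \<subseteq> S" using S openE by blast
  define N where "N = norm a + norm b + 1"
  have N: "N > 0" by (simp add: N_def add_nonneg_pos)
  interpret H: bounded_linear H using g by (rule has_derivative_bounded_linear)
  have "\<bar>H a \<bullet> b - H b \<bullet> a\<bar> \<le> \<eta> * (4 * N\<^sup>2)" if eta: "\<eta> > 0" for \<eta>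
  proof -
    obtain d where d: "d > 0" "\<And>y. norm (y - x) < d \<Longrightarrow> norm (g y - g x - H (y - x)) \<le> \<eta> * norm (y - x)"
      using g eta unfolding has_derivative_at_alt by blast
    define t where "t = min r d / (2 * N)"
    have t: "t > 0" "t * N < r" "t * N < d" using r(1) d(1) N by (auto simp: t_def)
    have near: "norm (s *\<^sub>R p + s' *\<^sub>R q) \<le> t * N"
      if "0 \<le> s" "s \<le> t" "0 \<le> s'" "s' \<le> t" "norm p + norm q + 1 = N" for s s' and p q :: 'a
    proof -
      have "norm (s *\<^sub>R p + s' *\<^sub>R q) \<le> s * norm p + s' * norm q"
        using norm_triangle_ineq[of "s *\<^sub>R p" "s' *\<^sub>R q"] that by simp
      also have "\<dots> \<le> t * norm p + t * norm q"
        using that by (intro add_mono mult_right_mono) auto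
      also have "\<dots> \<le> t * N" using t(1) that(5) by (auto simp: algebra_simps)
      finally show ?thesis .
    qed
    have diff: "\<bar>f (x + t *\<^sub>R p + t *\<^sub>R q) - f (x + t *\<^sub>R p) - f (x + t *\<^sub>R q) + f x - t\<^sup>2 * (H q \<bullet> p)\<bar>
        \<le> t\<^sup>2 * (\<eta> * (2 * N\<^sup>2))" if pq: "norm p + norm q + 1 = N" for p q
    proof -
      have inS: "x + s *\<^sub>R p + s' *\<^sub>R q \<in> S" if "0 \<le> s" "s \<le> t" "0 \<le> s'" "s' \<le> t" for s s'
        using near[OF that pq] r t by (intro subsetD[OF r(2)]) (metis add.assoc add_diff_cancel_left' dist_commute dist_norm le_less_trans mem_ball)
      have inS1: "x + s *\<^sub>R p \<in> S" if "0 \<le> s" "s \<le> t" for s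
        using inS[OF that, of 0] t by simp
      have D1: "((\<lambda>s. f ((x + t *\<^sub>R q) + s *\<^sub>R p)) has_real_derivative g ((x + t *\<^sub>R q) + s *\<^sub>R p) \<bullet> p) (at s)"
        if "0 \<le> s" "s \<le> t" for s
        by (rule has_real_derivative_along_line[OF f]) (use inS[OF that, of t] t in \<open>simp add: algebra_simps\<close>)
      have D2: "((\<lambda>s. f (x + s *\<^sub>R p)) has_real_derivative g (x + s *\<^sub>R p) \<bullet> p) (at s)"
        if "0 \<le> s" "s \<le> t" for s
        by (rule has_real_derivative_along_line[OF f]) (use inS1 that in auto)
      let ?k = "\<lambda>s. f ((x + t *\<^sub>R q) + s *\<^sub>R p) - f (x + s *\<^sub>R p)"
      let ?k' = "\<lambda>s. g ((x + t *\<^sub>R q) + s *\<^sub>R p) \<bullet> p - g (x + s *\<^sub>R p) \<bullet> p"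
      \<comment> \<open>Applied to the difference of \<open>f\<close> on two parallel segments, the
        mean value theorem leaves an increment of \<open>g\<close> over
        \<open>t *\<^sub>R q\<close>, which linearises to \<open>t *\<^sub>R H q\<close>.\<close>
      have "\<exists>z. 0 < z \<and> z < t \<and> ?k t - ?k 0 = (t - 0) * ?k' z"
        by (rule MVT2[OF t(1)]) (auto intro!: DERIV_diff D1 D2)
      then obtain z where z: "0 < z" "z < t" "?k t - ?k 0 = t * ?k' z" by auto
      have n1: "norm ((x + t *\<^sub>R q + z *\<^sub>R p) - x) \<le> t * N"
        using near[of z t p q] pq z by (simp add: algebra_simps)
      have n2: "norm ((x + z *\<^sub>R p) - x) \<le> t * N"
        using near[of z 0 p q] pq z by (simp add: algebra_simps)
      let ?e1 = "g (x + t *\<^sub>R q + z *\<^sub>R p) - g x - H ((x + t *\<^sub>R q + z *\<^sub>R p) - x)"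
      let ?e2 = "g (x + z *\<^sub>R p) - g x - H ((x + z *\<^sub>R p) - x)"
      have "norm ?e1 \<le> \<eta> * (t * N)"
        by (rule order_trans[OF d(2) mult_left_mono[OF n1]]) (use n1 t eta in auto)
      moreover have "norm ?e2 \<le> \<eta> * (t * N)"
        by (rule order_trans[OF d(2) mult_left_mono[OF n2]]) (use n2 t eta in auto)
      ultimately have e: "norm (?e1 - ?e2) \<le> 2 * \<eta> * t * N"
        using norm_triangle_ineq4[of ?e1 ?e2] by (simp add: algebra_simps)
      have "?e1 - ?e2 = g (x + t *\<^sub>R q + z *\<^sub>R p) - g (x + z *\<^sub>R p) - t *\<^sub>R H q"
        by (simp add: H.add H.scaleR algebra_simps)
      then have kz: "?k' z - t * (H q \<bullet> p) = (?e1 - ?e2) \<bullet> p"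
        by (simp only: inner_diff_left inner_scaleR_left)
      have "\<bar>(?e1 - ?e2) \<bullet> p\<bar> \<le> norm (?e1 - ?e2) * norm p" by (rule Cauchy_Schwarz_ineq2)
      also have "\<dots> \<le> (2 * \<eta> * t * N) * N"
        using e pq eta t N by (intro mult_mono) (auto simp: add_nonneg_nonneg)
      finally have "\<bar>?k' z - t * (H q \<bullet> p)\<bar> \<le> 2 * \<eta> * t * N * N" using kz by simp
      then have "\<bar>t * (?k' z - t * (H q \<bullet> p))\<bar> \<le> t * (2 * \<eta> * t * N * N)"
        using t(1) by (subst abs_mult) (auto intro!: mult_left_mono)
      then have "\<bar>t * ?k' z - t\<^sup>2 * (H q \<bullet> p)\<bar> \<le> t\<^sup>2 * (\<eta> * (2 * N\<^sup>2))"
        by (simp add: power2_eq_square algebra_simps)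
      then show ?thesis using z(3) by (simp add: algebra_simps)
    qed
    have "\<bar>t\<^sup>2 * (H a \<bullet> b) - t\<^sup>2 * (H b \<bullet> a)\<bar> \<le> t\<^sup>2 * (\<eta> * (4 * N\<^sup>2))"
      using diff[of a b] diff[of b a] by (simp add: N_def add.commute[of "norm b"] algebra_simps)
    then have "t\<^sup>2 * \<bar>H a \<bullet> b - H b \<bullet> a\<bar> \<le> t\<^sup>2 * (\<eta> * (4 * N\<^sup>2))"
      by (simp add: abs_mult flip: right_diff_distrib)
    then show ?thesis using t(1) by (subst (asm) mult_le_cancel_left_pos) auto
  qed
  then have *: "\<bar>H a \<bullet> b - H b \<bullet> a\<bar> \<le> \<eta>" if "\<eta> > 0" for \<eta>
    using that[THEN divide_pos_pos, of "4 * N\<^sup>2"] N by (metis divide_eq_eq mult_pos_pos nonzero_eq_divide_eq order_less_irrefl zero_less_numeral zero_less_power)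
  show ?thesis using field_le_epsilon[of "\<bar>H a \<bullet> b - H b \<bullet> a\<bar>" 0] * by simp
qed

section \<open>Integrals of derivatives of compactly supported functions\<close>

lemma integral_lborel_translate:
  fixes f :: "'a::euclidean_space \<Rightarrow> real"
  assumes "f \<in> borel_measurable borel"
  shows "(LINT x|lborel. f (c + x)) = (LINT x|lborel. f x)"
proof -
  have "(LINT x|lborel. f x) = (LINT x|distr lborel borel ((+) c). f x)"
    by (simp add: lborel_distr_plus)
  also have "\<dots> = (LINT x|lborel. f (c + x))"
    using assms by (subst integral_distr) auto
  finally show ?thesis by simp
qed

lemma integrable_continuous_compact_support:
  fixes f :: "'a::euclidean_space \<Rightarrow> real"
  assumes "continuous_on UNIV f" "compact K" "\<And>x. x \<notin> K \<Longrightarrow> f x = 0"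
  shows "integrable lborel f"
proof -
  have "(\<lambda>x. indicat_real K x *\<^sub>R f x) = f"
    using assms(3) by (auto simp: indicator_def fun_eq_iff)
  then show ?thesis
    using borel_integrable_compact[OF assms(2) continuous_on_subset[OF assms(1)]] by simp
qed

text \<open>By translation invariance every difference quotient of \<open>f\<close> has integral 0.\<close>

lemma integral_partial_derivative_zero:
  fixes f :: "'a::euclidean_space \<Rightarrow> real"
  assumes f: "\<And>x. (f has_derivative f' x) (at x)"
    and cont: "continuous_on UNIV (\<lambda>x. f' x e)"
    and K: "compact K" "\<And>x. x \<notin> K \<Longrightarrow> f x = 0" "\<And>x. x \<notin> K \<Longrightarrow> f' x e = 0"
  shows "(LINT x|lborel. f' x e) = 0"
proof -
  have "continuous_on K (\<lambda>x. f' x e)" using cont continuous_on_subset by blast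
  then have "bounded ((\<lambda>x. f' x e) ` K)" using K(1) compact_continuous_image compact_imp_bounded by blast
  then obtain B where "B > 0" "\<And>x. x \<in> K \<Longrightarrow> \<bar>f' x e\<bar> \<le> B" by (auto simp: bounded_pos)
  then have B: "\<bar>f' x e\<bar> \<le> B" for x using K(3) by (cases "x \<in> K") auto
  obtain r where r: "K \<subseteq> ball 0 r"
    using bounded_subset_ballD[OF compact_imp_bounded[OF K(1)]] by blast
  have fcont: "continuous_on UNIV f"
    using f has_derivative_continuous continuous_at_imp_continuous_on by blast
  have fint: "integrable lborel f"
    using integrable_continuous_compact_support[OF fcont K(1,2)] .
  have along: "((\<lambda>t. f (x + t *\<^sub>R e)) has_real_derivative f' (x + t *\<^sub>R e) e) (at t)" for x t
  proof -
    have "((\<lambda>t. x + t *\<^sub>R e) has_derivative (\<lambda>s. s *\<^sub>R e)) (at t)"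
      by (auto intro!: derivative_eq_intros)
    from has_derivative_compose[OF this f] show ?thesis
      using linear_cmul[OF has_derivative_linear[OF f]]
      by (simp add: has_field_derivative_def mult_commute_abs)
  qed
  define s where "s = (\<lambda>n::nat. \<lambda>x. (f ((1 / Suc n) *\<^sub>R e + x) - f x) / (1 / Suc n))"
  have meas: "f \<in> borel_measurable borel" using fcont by (rule borel_measurable_continuous_onI)
  have int0: "(LINT x|lborel. s n x) = 0" for n
  proof -
    have "integrable lborel (\<lambda>x. f ((1 / Suc n) *\<^sub>R e + x))"
    proof (rule integrable_continuous_compact_support[of _ "(+) (- (1 / Suc n) *\<^sub>R e) ` K"])
      show "continuous_on UNIV (\<lambda>x. f ((1 / Suc n) *\<^sub>R e + x))"
        by (intro continuous_on_compose2[OF fcont]) (auto intro!: continuous_intros)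
      show "compact ((+) (- (1 / Suc n) *\<^sub>R e) ` K)" using K(1) compact_translation by blast
      fix x assume "x \<notin> (+) (- (1 / Suc n) *\<^sub>R e) ` K"
      then have "(1 / Suc n) *\<^sub>R e + x \<notin> K"
        by (auto simp: image_iff algebra_simps)
      then show "f ((1 / Suc n) *\<^sub>R e + x) = 0" using K(2) by blast
    qed
    then show ?thesis unfolding s_def using fint integral_lborel_translate[OF meas]
      by simp
  qed
  \<comment> \<open>On the enlarged ball the quotient is a value of the derivative, by the mean
    value theorem. Outside it both \<open>x\<close> and the shifted point miss the support, as the
    shift is at most \<open>norm e\<close>.\<close>
  have bound: "norm (s n x) \<le> B * indicat_real (cball 0 (r + norm e)) x" for n x
  proof (cases "x \<in> cball 0 (r + norm e)")
    case True
    have "\<exists>z. 0 < z \<and> z < 1 / Suc n \<and> f (x + (1 / Suc n) *\<^sub>R e) - f (x + 0 *\<^sub>R e) = (1 / Suc n - 0) * f' (x + z *\<^sub>R e) e"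
      by (intro MVT2 along) auto
    then obtain z where "f (x + (1 / Suc n) *\<^sub>R e) - f x = (1 / Suc n) * f' (x + z *\<^sub>R e) e" by auto
    then have "s n x = f' (x + z *\<^sub>R e) e" by (simp add: s_def add.commute)
    then show ?thesis using True B by simp
  next
    case False
    then have "norm x > r + norm e" by simp
    moreover have "norm ((1 / Suc n) *\<^sub>R e) \<le> norm e"
      by (simp add: divide_le_eq mult_left_le[of _ "norm e", simplified mult.commute] algebra_simps)
    moreover have "norm x \<le> norm ((1 / Suc n) *\<^sub>R e + x) + norm ((1 / Suc n) *\<^sub>R e)"
      using norm_triangle_ineq4[of "(1 / Suc n) *\<^sub>R e + x" "(1 / Suc n) *\<^sub>R e"] by simp
    ultimately have "norm x > r" "norm ((1 / Suc n) *\<^sub>R e + x) > r" using norm_ge_zero[of e] by linarith+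
    then have "f x = 0" "f ((1 / Suc n) *\<^sub>R e + x) = 0" using r K(2) by force+
    then show ?thesis using False by (simp add: s_def)
  qed
  have lim: "(\<lambda>n. s n x) \<longlonglongrightarrow> f' x e" for x
  proof -
    have "((\<lambda>h. (f (x + h *\<^sub>R e) - f x) / h) \<longlongrightarrow> f' x e) (at 0)"
      using along[of x 0] by (simp add: DERIV_def)
    moreover have "filterlim (\<lambda>n. 1 / real (Suc n)) (at 0) sequentially"
      using LIMSEQ_inverse_real_of_nat by (auto simp: filterlim_at inverse_eq_divide)
    ultimately have "(\<lambda>n. (f (x + (1 / Suc n) *\<^sub>R e) - f x) / (1 / Suc n)) \<longlonglongrightarrow> f' x e"
      by (rule filterlim_compose)
    then show ?thesis by (simp add: s_def add.commute)
  qed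
  have "(\<lambda>n. LINT x|lborel. s n x) \<longlonglongrightarrow> (LINT x|lborel. f' x e)"
  proof (rule integral_dominated_convergence)
    show "(\<lambda>x. f' x e) \<in> borel_measurable lborel"
      using borel_measurable_continuous_onI[OF cont] by simp
    show "s n \<in> borel_measurable lborel" for n unfolding s_def using meas by measurable
    show "integrable lborel (\<lambda>x. B * indicat_real (cball 0 (r + norm e)) x)"
      by (intro integrable_mult_right integrable_real_indicator) (auto simp: emeasure_bounded_finite[unfolded infinity_ennreal_def])
    show "AE x in lborel. (\<lambda>n. s n x) \<longlonglongrightarrow> f' x e" using lim by simp
    show "AE x in lborel. norm (s n x) \<le> B * indicat_real (cball 0 (r + norm e)) x" for n
      using bound by simp
  qed
  then show ?thesis using int0 by (simp add: LIMSEQ_const_iff)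
qed

section \<open>Behaviour at the boundary\<close>

lemma has_derivative_inner_self_diff:
  fixes x z :: "'a::euclidean_space"
  shows "((\<lambda>x. (x - z) \<bullet> (x - z)) has_derivative (\<lambda>h. 2 * ((x - z) \<bullet> h))) (at x)"
  by (auto intro!: derivative_eq_intros simp: inner_commute)

text \<open>A positive value would persist on a neighbourhood and separate \<open>p\<close> from the
  closure of \<Omega>; a negative value would put \<open>p\<close> in \<Omega>, which as an open set
  misses its frontier.\<close>

lemma boundary_chart_frontier:
  assumes "boundary_chart \<Omega> p r \<phi> d\<phi>" "p \<in> frontier \<Omega>" "open \<Omega>"
  shows "\<phi> p = 0"
proof -
  obtain H where H: "r > 0" "C2_on_with (ball p r) \<phi> d\<phi> H"
    and \<Omega>: "\<Omega> \<inter> ball p r = {x \<in> ball p r. \<phi> x < 0}"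
    using assms(1) unfolding boundary_chart_def by blast
  have p: "p \<in> ball p r" "p \<notin> \<Omega>" "p \<in> closure \<Omega>"
    using assms(2,3) H(1) by (auto simp: frontier_def interior_open)
  then have "isCont \<phi> p"
    using H(2) has_derivative_continuous unfolding C2_on_with_def by blast
  have "\<not> \<phi> p > 0"
  proof
    assume "\<phi> p > 0"
    then have "\<forall>\<^sub>F x in nhds p. \<phi> x > 0"
      using \<open>isCont \<phi> p\<close> by (simp add: continuous_at order_tendstoD(1) tendsto_nhds_iff)
    then obtain S where S: "open S" "p \<in> S" "\<And>x. x \<in> S \<Longrightarrow> \<phi> x > 0"
      unfolding eventually_nhds by blast
    then have "(S \<inter> ball p r) \<inter> \<Omega> \<noteq> {}"
      using p open_Int_closure_eq_empty[of "S \<inter> ball p r" \<Omega>] by blast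
    then show False using S(3) \<Omega> by force
  qed
  moreover have "\<not> \<phi> p < 0" using \<Omega> p by blast
  ultimately show ?thesis by linarith
qed

lemma boundary_chart_inward:
  assumes "boundary_chart \<Omega> p r \<phi> d\<phi>" "p \<in> frontier \<Omega>" "open \<Omega>" "d\<phi> p \<bullet> d < 0"
  obtains t0 where "t0 > 0" "\<And>t. 0 < t \<Longrightarrow> t < t0 \<Longrightarrow> p + t *\<^sub>R d \<in> \<Omega>"
proof -
  obtain H where H: "r > 0" "C2_on_with (ball p r) \<phi> d\<phi> H"
    and \<Omega>: "\<Omega> \<inter> ball p r = {x \<in> ball p r. \<phi> x < 0}"
    using assms(1) unfolding boundary_chart_def by blast
  have "((\<lambda>t. \<phi> (p + t *\<^sub>R d)) has_real_derivative d\<phi> p \<bullet> d) (at 0)"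
    using H by (intro has_real_derivative_along_line) (auto simp: C2_on_with_def)
  from DERIV_neg_dec_right[OF this assms(4)] obtain t1 where
    t1: "t1 > 0" "\<And>t. 0 < t \<Longrightarrow> t < t1 \<Longrightarrow> \<phi> (p + t *\<^sub>R d) < 0"
    using boundary_chart_frontier[OF assms(1,2,3)] by auto
  obtain t2 where t2: "t2 > 0" "\<And>t. \<bar>t\<bar> < t2 \<Longrightarrow> p + t *\<^sub>R d \<in> ball p r"
    using line_in_open[of "ball p r" p, where e = d] H(1) by (metis centre_in_ball open_ball)
  show thesis
  proof (rule that[of "min t1 t2"])
    fix t assume "0 < t" "t < min t1 t2"
    then have "p + t *\<^sub>R d \<in> {x \<in> ball p r. \<phi> x < 0}" using t1 t2 by auto
    then show "p + t *\<^sub>R d \<in> \<Omega>" using \<Omega> by blast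
  qed (use t1 t2 in auto)
qed

text \<open>The interior sphere condition for the Hopf argument. In a ball tangent at
  \<open>p\<close> the square of the distance to \<open>p\<close> is dominated by the inward
  displacement, so for a small radius the quadratic error in expanding \<phi> at \<open>p\<close> is
  beaten by the linear term.\<close>

lemma boundary_chart_interior_ball:
  fixes \<Omega> :: "'a::euclidean_space set"
  assumes "boundary_chart \<Omega> p r \<phi> d\<phi>" "p \<in> frontier \<Omega>" "open \<Omega>"
  obtains \<rho> where "\<rho> > 0" "ball (p - \<rho> *\<^sub>R (d\<phi> p /\<^sub>R norm (d\<phi> p))) \<rho> \<subseteq> \<Omega>"
proof -
  obtain H where H: "r > 0" "C2_on_with (ball p r) \<phi> d\<phi> H" "d\<phi> p \<noteq> 0"
    and \<Omega>: "\<Omega> \<inter> ball p r = {x \<in> ball p r. \<phi> x < 0}"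
    using assms(1) unfolding boundary_chart_def by force
  have d\<phi>: "(\<phi> has_derivative (\<lambda>h. d\<phi> x \<bullet> h)) (at x)" if "x \<in> ball p r" for x
    using H(2) that unfolding C2_on_with_def by blast
  have dd: "(d\<phi> has_derivative H p) (at p)" using H(1,2) unfolding C2_on_with_def by simp
  \<comment> \<open>A Lipschitz constant for \<open>d\<phi>\<close> relative to \<open>p\<close>:
    the norm of the Hessian, plus 1 for the error of differentiability.\<close>
  define A where "A = onorm (H p) + 1"
  have bl: "bounded_linear (H p)" using dd by (rule has_derivative_bounded_linear)
  have A: "A > 0" using onorm_pos_le[OF bl] by (simp add: A_def)
  obtain s where s: "s > 0" "\<And>y. norm (y - p) < s \<Longrightarrow> norm (d\<phi> y - d\<phi> p - H p (y - p)) \<le> 1 * norm (y - p)"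
    using dd unfolding has_derivative_at_alt by (meson zero_less_one)
  have lip: "norm (d\<phi> y - d\<phi> p) \<le> A * norm (y - p)" if "norm (y - p) < s" for y
    using s(2)[OF that] onorm[OF bl, of "y - p"] norm_triangle_sub[of "d\<phi> y - d\<phi> p" "H p (y - p)"]
    by (simp add: A_def algebra_simps)
  define \<nu> where "\<nu> = d\<phi> p /\<^sub>R norm (d\<phi> p)"
  have \<nu>: "norm \<nu> = 1" "d\<phi> p = norm (d\<phi> p) *\<^sub>R \<nu>" using H(3) by (auto simp: \<nu>_def)
  \<comment> \<open>Points of the ball have distance below \<open>2 * \<rho>\<close> from
    \<open>p\<close>; the thirds keep them in the chart and in the Lipschitz range, and the last
    bound gives \<open>2 * \<rho> * A \<le> norm (d\<phi> p)\<close>, which absorbs the quadratic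
    error.\<close>
  define \<rho> where "\<rho> = min (min (r / 3) (s / 3)) (norm (d\<phi> p) / (2 * A))"
  have "norm (d\<phi> p) > 0" using H(3) by simp
  then have \<rho>: "\<rho> > 0" "2 * \<rho> < r" "2 * \<rho> < s" and "\<rho> \<le> norm (d\<phi> p) / (2 * A)"
    using H(1) s(1) A by (auto simp: \<rho>_def)
  then have \<rho>A: "2 * \<rho> * A \<le> norm (d\<phi> p)" using A by (simp add: field_simps)
  show thesis
  proof (rule that[OF \<rho>(1)], rule subsetI)
    fix x assume "x \<in> ball (p - \<rho> *\<^sub>R (d\<phi> p /\<^sub>R norm (d\<phi> p))) \<rho>"
    then have x: "norm (x - p + \<rho> *\<^sub>R \<nu>) < \<rho>"
      by (simp add: \<nu>_def dist_norm norm_minus_commute algebra_simps)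
    define d where "d = x - p"
    have "(norm (d + \<rho> *\<^sub>R \<nu>))\<^sup>2 < \<rho>\<^sup>2"
      using x by (intro power_strict_mono) (auto simp: d_def)
    moreover have "(norm (d + \<rho> *\<^sub>R \<nu>))\<^sup>2 = (norm d)\<^sup>2 + 2 * \<rho> * (d \<bullet> \<nu>) + \<rho>\<^sup>2"
      using \<nu>(1) by (simp add: power2_norm_eq_inner inner_add_left inner_add_right norm_eq_1 inner_commute algebra_simps)
        (simp add: power2_eq_square)
    ultimately have sq: "(norm d)\<^sup>2 < - (2 * \<rho> * (d \<bullet> \<nu>))" by simp
    then have neg: "d \<bullet> \<nu> < 0"
      using \<rho>(1) zero_le_power2[of "norm d"] by (smt (verit) mult_nonneg_nonneg)
    have "norm d \<le> norm (d + \<rho> *\<^sub>R \<nu>) + norm (\<rho> *\<^sub>R \<nu>)"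
      using norm_triangle_ineq4[of "d + \<rho> *\<^sub>R \<nu>" "\<rho> *\<^sub>R \<nu>"] by simp
    then have nd: "norm d < 2 * \<rho>" using x \<nu>(1) \<rho>(1) by (simp add: d_def)
    have inb: "p + t *\<^sub>R d \<in> ball p r" "norm ((p + t *\<^sub>R d) - p) \<le> norm d" "norm ((p + t *\<^sub>R d) - p) < s"
      if "0 \<le> t" "t \<le> 1" for t
    proof -
      show 1: "norm ((p + t *\<^sub>R d) - p) \<le> norm d" using that by (simp add: mult_left_le_one_le)
      show "norm ((p + t *\<^sub>R d) - p) < s" using 1 nd \<rho> by linarith
      show "p + t *\<^sub>R d \<in> ball p r" using 1 nd \<rho> by (simp add: dist_norm)
    qed
    have "continuous_on {0..1} (\<lambda>t. \<phi> (p + t *\<^sub>R d))"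
      by (rule DERIV_continuous_on, rule has_real_derivative_along_line[OF d\<phi>]) (use inb in auto)
    then have "\<exists>t. 0 < t \<and> t < 1 \<and> \<phi> (p + 1 *\<^sub>R d) - \<phi> p = 1 * (d\<phi> (p + t *\<^sub>R d) \<bullet> d)"
      by (rule gradient_mean_value[OF zero_less_one]) (use d\<phi> inb in auto)
    then obtain t where t: "0 < t" "t < 1" and mv: "\<phi> (p + d) - \<phi> p = d\<phi> (p + t *\<^sub>R d) \<bullet> d" by auto
    have "(d\<phi> (p + t *\<^sub>R d) - d\<phi> p) \<bullet> d \<le> norm (d\<phi> (p + t *\<^sub>R d) - d\<phi> p) * norm d"
      by (rule norm_cauchy_schwarz)
    also have "\<dots> \<le> (A * norm d) * norm d"
      by (intro mult_right_mono order_trans[OF lip[OF inb(3)]] mult_left_mono inb(2)) (use t A in auto)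
    also have "\<dots> = A * (norm d)\<^sup>2" by (simp add: power2_eq_square)
    also have "\<dots> < A * (- (2 * \<rho> * (d \<bullet> \<nu>)))" using sq A by (intro mult_strict_left_mono) auto
    also have "\<dots> = 2 * \<rho> * A * (- (d \<bullet> \<nu>))" by simp
    also have "\<dots> \<le> norm (d\<phi> p) * (- (d \<bullet> \<nu>))" using \<rho>A neg by (intro mult_right_mono) auto
    also have "\<dots> = - (d\<phi> p \<bullet> d)" by (subst (2) \<nu>(2)) (simp add: inner_commute)
    finally have "\<phi> (p + d) < 0"
      using mv boundary_chart_frontier[OF assms] by (simp add: inner_diff_left)
    then have "x \<in> {x \<in> ball p r. \<phi> x < 0}" using inb(1)[of 1] by (simp add: d_def)
    then show "x \<in> \<Omega>" using \<Omega> by blast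
  qed
qed

section \<open>The overdetermined problem: minimum principle and boundary gradient\<close>

locale overdetermined_torsion =
  fixes \<Omega> :: "'a::euclidean_space set"
    and u :: "'a \<Rightarrow> real" and g :: "'a \<Rightarrow> 'a" and H :: "'a \<Rightarrow> 'a \<Rightarrow> 'a"
    and c :: real
  assumes domain: "bounded_domain \<Omega>"
    and C2_bdry: "C2_boundary \<Omega>"
    and C2_u: "C2_closure_with \<Omega> u g H"
    and laplacian: "\<And>x. x \<in> \<Omega> \<Longrightarrow> laplacian_of H x = -1"
    and dirichlet: "\<And>x. x \<in> frontier \<Omega> \<Longrightarrow> u x = 0"
    and neumann: "\<And>x. x \<in> frontier \<Omega> \<Longrightarrow> g x \<bullet> outward_normal \<Omega> x = c * norm x"
begin

lemma open_dom: "open \<Omega>" and connected_dom: "connected \<Omega>" and dom_nonempty: "\<Omega> \<noteq> {}"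
  and bounded_dom: "bounded \<Omega>"
  using domain by (auto simp: bounded_domain_def)

lemma compact_closure_dom: "compact (closure \<Omega>)"
  using bounded_dom by simp

lemma closure_dom_eq: "closure \<Omega> = \<Omega> \<union> frontier \<Omega>"
  using closure_subset[of \<Omega>] by (auto simp: frontier_def interior_open[OF open_dom])

lemma frontier_disjoint_dom: "x \<in> frontier \<Omega> \<Longrightarrow> x \<notin> \<Omega>"
  by (simp add: frontier_def interior_open[OF open_dom])

lemma u_deriv: "x \<in> \<Omega> \<Longrightarrow> (u has_derivative (\<lambda>h. g x \<bullet> h)) (at x)"
  and g_deriv: "x \<in> \<Omega> \<Longrightarrow> (g has_derivative H x) (at x)"
  and u_cont: "continuous_on (closure \<Omega>) u"
  and g_cont: "continuous_on (closure \<Omega>) g"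
  using C2_u by (auto simp: C2_closure_with_def C2_on_with_def)

lemma H_cont: "i \<in> Basis \<Longrightarrow> continuous_on \<Omega> (\<lambda>x. H x i)"
  using C2_u by (subst continuous_on_componentwise) (auto simp: C2_closure_with_def C2_on_with_def)

lemma H_symmetric: "x \<in> \<Omega> \<Longrightarrow> H x a \<bullet> b = H x b \<bullet> a"
  using second_derivative_symmetric[OF open_dom _ u_deriv g_deriv] by blast

text \<open>The function has Laplacian \<open>2 * real DIM('a) * \<kappa> - 1 < 0\<close>, but at an
  interior minimum it would be nonnegative. The case \<kappa> = 0 is the minimum principle for
  \<open>u\<close>; a positive \<kappa> gives the barrier of the Hopf argument.\<close>

lemma no_interior_minimum:
  assumes "open S" "S \<subseteq> \<Omega>" "y \<in> S" "2 * real DIM('a) * \<kappa> < 1"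
    and min: "\<And>x. x \<in> S \<Longrightarrow> u y + \<kappa> * (norm (y - z))\<^sup>2 \<le> u x + \<kappa> * (norm (x - z))\<^sup>2"
  shows False
proof -
  let ?f = "\<lambda>x. - (u x + \<kappa> * ((x - z) \<bullet> (x - z)))"
  let ?G = "\<lambda>x. - (g x + (2 * \<kappa>) *\<^sub>R (x - z))"
  let ?H = "\<lambda>x h. - (H x h + (2 * \<kappa>) *\<^sub>R h)"
  have "laplacian_of ?H y \<le> 0"
  proof (rule laplacian_nonpos_at_max[OF assms(1,3)])
    show "?f x \<le> ?f y" if "x \<in> S" for x using min[OF that] by (simp add: power2_norm_eq_inner)
    show "(?f has_derivative (\<lambda>h. ?G x \<bullet> h)) (at x)" if "x \<in> S" for x
    proof -
      have "x \<in> \<Omega>" using that assms(2) by blast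
      from has_derivative_minus[OF has_derivative_add[OF u_deriv[OF this]
            has_derivative_mult_right[OF has_derivative_inner_self_diff, of \<kappa> z]]]
      show ?thesis
        by (rule has_derivative_eq_rhs) (simp add: fun_eq_iff inner_add_left inner_diff_left algebra_simps)
    qed
    show "(?G has_derivative ?H y) (at y)"
      using assms(2,3) by (auto intro!: derivative_eq_intros g_deriv)
  qed
  moreover have "laplacian_of ?H y = - laplacian_of H y - 2 * real DIM('a) * \<kappa>"
    by (simp add: laplacian_of_def inner_diff_left inner_add_left sum.distrib sum_negf sum_subtractf)
  moreover have "laplacian_of H y = -1" using laplacian assms(2,3) by blast
  ultimately show False using assms(4) by linarith
qed

lemma u_pos: assumes "x \<in> \<Omega>" shows "u x > 0"
proof (rule ccontr)
  assume ux: "\<not> u x > 0"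
  have "closure \<Omega> \<noteq> {}" using dom_nonempty by simp
  then obtain y where y: "y \<in> closure \<Omega>" "\<And>z. z \<in> closure \<Omega> \<Longrightarrow> u y \<le> u z"
    using continuous_attains_inf[OF compact_closure_dom _ u_cont] by blast
  have "\<exists>z\<in>\<Omega>. \<forall>w\<in>\<Omega>. u z \<le> u w"
  \<comment> \<open>If the minimum over the closure sits on the boundary, it is 0, and the point
    \<open>x\<close> with \<open>u x \<le> 0\<close> is itself an interior minimiser.\<close>
  proof (cases "y \<in> \<Omega>")
    case True
    then show ?thesis using y(2) closure_subset by blast
  next
    case False
    then have "u y = 0" using y(1) closure_dom_eq dirichlet by blast
    then show ?thesis using ux assms y(2) closure_subset by (metis dual_order.trans not_le subsetD)
  qed
  then show False using no_interior_minimum[OF open_dom order_refl, of _ 0] by auto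
qed

lemma u_nonneg: "x \<in> closure \<Omega> \<Longrightarrow> u x \<ge> 0"
  using u_pos dirichlet closure_dom_eq by force

text \<open>On the frontier \<open>g\<close> is known only as a continuous extension of the
  gradient. If \<open>g p \<bullet> d\<close> were below \<kappa>, then so would
  \<open>g \<bullet> d\<close> be at nearby interior points, and the mean value theorem along the
  segment from \<open>p\<close> would make \<open>u\<close> too small.\<close>

lemma g_inner_ge:
  assumes p: "p \<in> frontier \<Omega>" and t0: "t0 > 0" "\<And>t. 0 < t \<Longrightarrow> t < t0 \<Longrightarrow> p + t *\<^sub>R d \<in> \<Omega>"
    and ge: "\<And>t. 0 < t \<Longrightarrow> t < t0 \<Longrightarrow> u (p + t *\<^sub>R d) \<ge> \<kappa> * t"
  shows "g p \<bullet> d \<ge> \<kappa>"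
proof (rule ccontr)
  assume "\<not> g p \<bullet> d \<ge> \<kappa>"
  have pc: "p \<in> closure \<Omega>" using p closure_dom_eq by blast
  have "continuous_on (closure \<Omega>) (\<lambda>x. g x \<bullet> d)" by (intro continuous_intros g_cont)
  then have "((\<lambda>x. g x \<bullet> d) \<longlongrightarrow> g p \<bullet> d) (at p within closure \<Omega>)"
    using pc by (simp add: continuous_on_def)
  then have "\<forall>\<^sub>F x in at p within closure \<Omega>. g x \<bullet> d < \<kappa>"
    using \<open>\<not> g p \<bullet> d \<ge> \<kappa>\<close> by (intro order_tendstoD(2)) auto
  then obtain e where e: "e > 0" "\<And>x. x \<in> closure \<Omega> \<Longrightarrow> x \<noteq> p \<Longrightarrow> dist x p < e \<Longrightarrow> g x \<bullet> d < \<kappa>"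
    unfolding eventually_at by blast
  obtain t1 where t1: "t1 > 0" "\<And>t. \<bar>t\<bar> < t1 \<Longrightarrow> p + t *\<^sub>R d \<in> ball p e"
    using line_in_open[of "ball p e" p, where e = d] e(1) by (metis centre_in_ball open_ball)
  define t where "t = min t0 t1 / 2"
  have t: "0 < t" "t < t0" "t < t1" using t0(1) t1(1) by (auto simp: t_def)
  have "p + s *\<^sub>R d \<in> closure \<Omega>" if "0 \<le> s" "s \<le> t" for s
    using t0(2)[of s] that t pc closure_subset by (cases "s = 0") auto
  then have "continuous_on {0..t} (\<lambda>s. u (p + s *\<^sub>R d))"
    by (intro continuous_on_compose2[OF u_cont] continuous_intros) auto
  then have "\<exists>s. 0 < s \<and> s < t \<and> u (p + t *\<^sub>R d) - u p = t * (g (p + s *\<^sub>R d) \<bullet> d)"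
    by (rule gradient_mean_value[OF t(1)]) (use t0(2) t u_deriv in auto)
  then obtain s where s: "0 < s" "s < t" "u (p + t *\<^sub>R d) = t * (g (p + s *\<^sub>R d) \<bullet> d)"
    using dirichlet[OF p] by auto
  have "p + s *\<^sub>R d \<in> \<Omega>" using t0(2) s t by simp
  moreover from this have "p + s *\<^sub>R d \<noteq> p" using frontier_disjoint_dom[OF p] by metis
  moreover have "dist (p + s *\<^sub>R d) p < e" using t1(2)[of s] s t by (simp add: dist_commute)
  ultimately have "g (p + s *\<^sub>R d) \<bullet> d < \<kappa>" using e(2) closure_subset by blast
  then show False using ge[of t] s t by (simp add: mult.commute)
qed

text \<open>As \<open>\<Delta>u = -1\<close>, a concave paraboloid is a sufficient barrier on an interior ball.\<close>

lemma hopf: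
  assumes p: "p \<in> frontier \<Omega>" and chart: "boundary_chart \<Omega> p r \<phi> d\<phi>"
  shows "g p \<bullet> (d\<phi> p /\<^sub>R norm (d\<phi> p)) < 0"
proof -
  define \<nu> where "\<nu> = d\<phi> p /\<^sub>R norm (d\<phi> p)"
  have \<nu>: "norm \<nu> = 1"
    using chart unfolding boundary_chart_def by (simp add: \<nu>_def)
  obtain \<rho> where \<rho>: "\<rho> > 0" "ball (p - \<rho> *\<^sub>R \<nu>) \<rho> \<subseteq> \<Omega>"
    using boundary_chart_interior_ball[OF chart p open_dom] unfolding \<nu>_def by metis
  define z where "z = p - \<rho> *\<^sub>R \<nu>"
  \<comment> \<open>With this choice \<open>2 * real DIM('a) * \<kappa>\<close> is 1/2, so
    \<open>?f\<close> has no interior minimum.\<close>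
  define \<kappa> where "\<kappa> = 1 / (4 * real DIM('a))"
  have \<kappa>: "\<kappa> > 0" "2 * real DIM('a) * \<kappa> < 1" by (auto simp: \<kappa>_def)
  let ?f = "\<lambda>x. u x + \<kappa> * (norm (x - z))\<^sup>2"
  have cb: "cball z \<rho> \<subseteq> closure \<Omega>"
    using closure_mono[OF \<rho>(2)] \<rho>(1) by (simp add: z_def)
  then have "continuous_on (cball z \<rho>) ?f"
    by (intro continuous_intros continuous_on_subset[OF u_cont])
  moreover have "cball z \<rho> \<noteq> {}" using \<rho>(1) by simp
  ultimately obtain y where y: "y \<in> cball z \<rho>" "\<And>x. x \<in> cball z \<rho> \<Longrightarrow> ?f y \<le> ?f x"
    using continuous_attains_inf[OF compact_cball] by blast
  \<comment> \<open>The minimum is thus attained on the sphere, where \<open>u \<ge> 0\<close>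
    bounds \<open>?f\<close> below by \<open>\<kappa> * \<rho>\<^sup>2\<close>. Moving inward from
    \<open>p\<close> shrinks the paraboloid, so \<open>u\<close> must grow at least
    linearly.\<close>
  have "y \<notin> ball z \<rho>"
    using no_interior_minimum[of "ball z \<rho>" y \<kappa> z] y(2) \<rho>(2) \<kappa> by (auto simp: z_def)
  then have "norm (y - z) = \<rho>" using y(1) by (simp add: dist_norm norm_minus_commute)
  then have fy: "?f y \<ge> \<kappa> * \<rho>\<^sup>2" using u_nonneg[of y] cb y(1) by auto
  have ball: "p + t *\<^sub>R (- \<nu>) \<in> ball z \<rho>" and nrm: "norm (p + t *\<^sub>R (- \<nu>) - z) = \<rho> - t"
    if "0 < t" "t < \<rho>" for t
  proof -
    have "p + t *\<^sub>R (- \<nu>) - z = (\<rho> - t) *\<^sub>R \<nu>" by (simp add: z_def algebra_simps)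
    then show "norm (p + t *\<^sub>R (- \<nu>) - z) = \<rho> - t" using that \<nu> by simp
    then show "p + t *\<^sub>R (- \<nu>) \<in> ball z \<rho>" using that by (simp add: dist_norm norm_minus_commute)
  qed
  have "g p \<bullet> (- \<nu>) \<ge> \<kappa> * \<rho>"
  proof (rule g_inner_ge[OF p \<rho>(1)])
    fix t assume t: "0 < t" "t < \<rho>"
    show "p + t *\<^sub>R (- \<nu>) \<in> \<Omega>" using ball[OF t] \<rho>(2) by (auto simp: z_def)
    have "\<kappa> * \<rho>\<^sup>2 \<le> u (p + t *\<^sub>R (- \<nu>)) + \<kappa> * (\<rho> - t)\<^sup>2"
      using fy y(2)[of "p + t *\<^sub>R (- \<nu>)"] ball[OF t] nrm[OF t] by auto
    moreover have "\<kappa> * \<rho>\<^sup>2 - \<kappa> * (\<rho> - t)\<^sup>2 - \<kappa> * \<rho> * t = \<kappa> * (t * (\<rho> - t))"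
      by (simp add: power2_eq_square algebra_simps)
    moreover have "\<kappa> * (t * (\<rho> - t)) \<ge> 0" using t \<kappa> by simp
    ultimately show "\<kappa> * \<rho> * t \<le> u (p + t *\<^sub>R (- \<nu>))" by linarith
  qed
  then show ?thesis using \<kappa> \<rho>(1) unfolding \<nu>_def[symmetric]
    by (smt (verit) inner_minus_right mult_pos_pos)
qed

text \<open>Positivity of \<open>u\<close> makes every inward derivative nonnegative; letting the direction become tangential,
  both signs of a tangential derivative are excluded, so the boundary need not be parametrised.\<close>

lemma gradient_normal:
  assumes p: "p \<in> frontier \<Omega>" and chart: "boundary_chart \<Omega> p r \<phi> d\<phi>"
  defines "\<nu> \<equiv> d\<phi> p /\<^sub>R norm (d\<phi> p)"
  shows "g p = (g p \<bullet> \<nu>) *\<^sub>R \<nu>"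
proof -
  have d\<phi>: "d\<phi> p \<noteq> 0" using chart unfolding boundary_chart_def by auto
  then have "norm \<nu> = 1" by (simp add: \<nu>_def)
  then have \<nu>: "\<nu> \<bullet> \<nu> = 1" by (simp add: norm_eq_1)
  have *: "g p \<bullet> d \<ge> 0" if "\<nu> \<bullet> d < 0" for d
  proof -
    have "d\<phi> p \<bullet> d < 0" using that d\<phi> by (simp add: \<nu>_def mult_less_0_iff zero_less_mult_iff)
    then obtain t0 where "t0 > 0" "\<And>t. 0 < t \<Longrightarrow> t < t0 \<Longrightarrow> p + t *\<^sub>R d \<in> \<Omega>"
      using boundary_chart_inward[OF chart p open_dom] by metis
    then show ?thesis using u_pos by (intro g_inner_ge[OF p]) (auto intro: less_imp_le)
  qed
  define \<tau> where "\<tau> = g p - (g p \<bullet> \<nu>) *\<^sub>R \<nu>"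
  have \<tau>: "\<nu> \<bullet> \<tau> = 0" "g p \<bullet> \<tau> = \<tau> \<bullet> \<tau>"
    using \<nu> by (auto simp: \<tau>_def inner_diff_right inner_diff_left inner_commute algebra_simps)
  have "\<tau> \<bullet> \<tau> \<le> e" if "e > 0" for e
  proof -
    \<comment> \<open>Tilting the direction by \<open>s\<close> makes it strictly inward, at a cost
      of at most \<open>e\<close>; the 1 guards against a zero denominator.\<close>
    define s where "s = e / (\<bar>g p \<bullet> \<nu>\<bar> + 1)"
    have s: "s > 0" "s * \<bar>g p \<bullet> \<nu>\<bar> \<le> e" using that by (auto simp: s_def field_simps)
    have "\<nu> \<bullet> (- \<tau> - s *\<^sub>R \<nu>) < 0" using \<tau> \<nu> s by (simp add: inner_diff_right)
    from *[OF this] have "\<tau> \<bullet> \<tau> \<le> - (s * (g p \<bullet> \<nu>))" using \<tau> by (simp add: inner_diff_right)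
    also have "\<dots> \<le> s * \<bar>g p \<bullet> \<nu>\<bar>" using s(1) by (smt (verit) mult_minus_right mult_left_mono)
    finally show ?thesis using s by linarith
  qed
  then have "\<tau> \<bullet> \<tau> \<le> 0" using field_le_epsilon[of "\<tau> \<bullet> \<tau>" 0] by simp
  then have "\<tau> = 0" by (metis inner_ge_zero inner_eq_zero_iff order_antisym)
  then show ?thesis by (simp add: \<tau>_def)
qed

text \<open>The Hopf inequality reads \<open>c * norm p < 0\<close>. This fixes the sign of
  \<open>c\<close>, as a bounded nonempty set has a boundary point, and keeps the origin off the
  boundary. The gradient being normal, its norm is the absolute value of the Neumann datum.\<close>

lemma c_neg: "c < 0"
  and frontier_nonzero: "p \<in> frontier \<Omega> \<Longrightarrow> p \<noteq> 0"
  and norm_g_frontier: "p \<in> frontier \<Omega> \<Longrightarrow> norm (g p) = - c * norm p"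
proof -
  have *: "c * norm p < 0 \<and> norm (g p) = - c * norm p" if p: "p \<in> frontier \<Omega>" for p
  proof -
    \<comment> \<open>\<open>hopf\<close> and \<open>gradient_normal\<close> hold for every chart,
      so the chart behind the choice operator in \<open>outward_normal\<close> serves.\<close>
    have "\<exists>\<nu> r \<phi> d\<phi>. boundary_chart \<Omega> p r \<phi> d\<phi> \<and> \<nu> = d\<phi> p /\<^sub>R norm (d\<phi> p)"
      using C2_bdry p unfolding C2_boundary_def by blast
    then have "\<exists>r \<phi> d\<phi>. boundary_chart \<Omega> p r \<phi> d\<phi> \<and> outward_normal \<Omega> p = d\<phi> p /\<^sub>R norm (d\<phi> p)"
      unfolding outward_normal_def by (rule someI_ex)
    then obtain r \<phi> d\<phi> where chart: "boundary_chart \<Omega> p r \<phi> d\<phi>"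
      and \<nu>: "outward_normal \<Omega> p = d\<phi> p /\<^sub>R norm (d\<phi> p)" by blast
    have neg: "c * norm p < 0" using hopf[OF p chart] neumann[OF p] \<nu> by simp
    have "norm (outward_normal \<Omega> p) = 1"
      using chart \<nu> unfolding boundary_chart_def by simp
    moreover have "g p = (c * norm p) *\<^sub>R outward_normal \<Omega> p"
      using gradient_normal[OF p chart] neumann[OF p] \<nu> by simp
    ultimately have "norm (g p) = \<bar>c * norm p\<bar>" by simp
    then show ?thesis using neg by simp
  qed
  have "frontier \<Omega> \<noteq> {}"
    using frontier_eq_empty dom_nonempty bounded_dom not_bounded_UNIV by metis
  then show "c < 0" using * by (metis all_not_in_conv mult_less_0_iff norm_ge_zero not_le)
  show "p \<in> frontier \<Omega> \<Longrightarrow> p \<noteq> 0" "p \<in> frontier \<Omega> \<Longrightarrow> norm (g p) = - c * norm p" using * by force+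
qed

end

section \<open>The divergence theorem with cutoffs\<close>

lemma continuous_on_zero_extension:
  fixes k :: "'a::euclidean_space \<Rightarrow> real"
  assumes "open S" "compact K" "K \<subseteq> S" "continuous_on S k" "\<And>x. x \<in> S - K \<Longrightarrow> k x = 0"
  shows "continuous_on UNIV (\<lambda>x. if x \<in> S then k x else 0)" (is "continuous_on UNIV ?k")
proof -
  have "continuous_on S ?k" using assms(4) by (rule continuous_on_eq) simp
  moreover have "continuous_on (- K) ?k"
    by (rule continuous_on_eq[OF continuous_on_const[of _ 0]]) (use assms(5) in auto)
  ultimately have "continuous_on (S \<union> - K) ?k"
    using assms(1,2) by (intro continuous_on_open_Un) (auto intro: compact_imp_closed)
  moreover have "S \<union> - K = UNIV" using assms(3) by blast
  ultimately show ?thesis by simp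
qed

text \<open>A field vanishing off \<open>K\<close> extends by 0 to a differentiable field on the
  whole space; each diagonal term of the divergence is then a partial derivative with compact
  support and integrates to 0.\<close>

lemma integral_divergence_zero:
  fixes Y :: "'a::euclidean_space \<Rightarrow> 'a"
  assumes S: "open S" and K: "compact K" "K \<subseteq> S"
    and Y: "\<And>x. x \<in> S \<Longrightarrow> (Y has_derivative Y' x) (at x)"
    and cont: "\<And>i. i \<in> Basis \<Longrightarrow> continuous_on S (\<lambda>x. Y' x i \<bullet> i)"
    and zero: "\<And>x. x \<in> S - K \<Longrightarrow> Y x = 0"
  shows "(LINT x|lborel. (if x \<in> S then \<Sum>i\<in>Basis. Y' x i \<bullet> i else 0)) = 0"
proof -
  have oK: "open (- K)" using K by (simp add: compact_imp_closed open_Compl)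
  have Y'0: "Y' x = (\<lambda>h. 0)" if x: "x \<in> S - K" for x
  proof -
    have "(Y has_derivative (\<lambda>h. 0)) (at x)"
      by (rule has_derivative_transform_within_open[OF has_derivative_const[of 0] _ x])
        (use S oK zero in \<open>auto simp: Diff_eq\<close>)
    then show ?thesis using has_derivative_unique[OF Y] x by blast
  qed
  let ?d = "\<lambda>i x. if x \<in> S then Y' x i \<bullet> i else 0"
  have one: "integrable lborel (?d i) \<and> (LINT x|lborel. ?d i x) = 0" if i: "i \<in> Basis" for i
  proof
    have c: "continuous_on UNIV (?d i)"
      by (rule continuous_on_zero_extension[OF S K cont[OF i]]) (simp add: Y'0)
    then show "integrable lborel (?d i)"
      by (rule integrable_continuous_compact_support[OF _ K(1)]) (simp add: Y'0)
    let ?f = "\<lambda>x. if x \<in> S then Y x \<bullet> i else 0"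
    let ?f' = "\<lambda>x h. if x \<in> S then Y' x h \<bullet> i else 0"
    have "(LINT x|lborel. ?f' x i) = 0"
    proof (rule integral_partial_derivative_zero[of ?f ?f' i K])
      show "continuous_on UNIV (\<lambda>x. ?f' x i)" by (rule c)
      show "(?f has_derivative ?f' x) (at x)" for x
      proof (cases "x \<in> S")
        case True
        have "((\<lambda>x. Y x \<bullet> i) has_derivative (\<lambda>h. Y' x h \<bullet> i)) (at x)"
          by (intro has_derivative_inner_left Y True)
        then have "(?f has_derivative (\<lambda>h. Y' x h \<bullet> i)) (at x)"
          by (rule has_derivative_transform_within_open[OF _ S True]) simp
        then show ?thesis using True by simp
      next
        case False
        then have "x \<in> - K" using K by blast
        then have "(?f has_derivative (\<lambda>h. 0)) (at x)"
          by (rule has_derivative_transform_within_open[OF has_derivative_const[of 0] oK]) (simp add: zero)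
        then show ?thesis using False by simp
      qed
    qed (auto simp: zero Y'0 K(1))
    then show "(LINT x|lborel. ?d i x) = 0" .
  qed
  have "(\<lambda>x. if x \<in> S then \<Sum>i\<in>Basis. Y' x i \<bullet> i else 0) = (\<lambda>x. \<Sum>i\<in>Basis. ?d i x)"
    by auto
  then show ?thesis using one by (simp add: Bochner_Integration.integral_sum)
qed

text \<open>A zero integral would make the nonempty open set where \<open>f\<close> is nonzero
  negligible.\<close>

lemma integral_continuous_pos:
  fixes f :: "'a::euclidean_space \<Rightarrow> real"
  assumes f: "continuous_on UNIV f" "integrable lborel f" and nonneg: "\<And>x. f x \<ge> 0" and pos: "f x0 > 0"
  shows "(LINT x|lborel. f x) > 0"
proof (rule ccontr)
  assume "\<not> ?thesis"
  moreover have "(LINT x|lborel. f x) \<ge> 0" by (rule Bochner_Integration.integral_nonneg) (rule nonneg)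
  ultimately have "(LINT x|lborel. f x) = 0" by linarith
  then have "AE x in lborel. f x = 0"
    using integral_nonneg_eq_0_iff_AE[OF f(2)] nonneg by simp
  moreover have "f \<in> borel_measurable lborel" using f(2) by simp
  ultimately have "{x. f x \<noteq> 0} \<in> null_sets lborel"
    by (subst (asm) AE_iff_null) auto
  then have "negligible {x. f x \<noteq> 0}"
    by (simp add: negligible_iff_null_sets null_sets_completionI)
  moreover have "open {x. f x \<noteq> 0}" using f(1) by (intro open_Collect_neq) auto
  ultimately show False using open_not_negligible pos by force
qed

section \<open>A cutoff built from squares of positive parts\<close>

lemma DERIV_max_0_power2:
  "((\<lambda>x. (max 0 x)\<^sup>2) has_real_derivative 2 * max 0 x) (at (x::real))"
proof -
  consider "x > 0" | "x < 0" | "x = 0" by linarith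
  then show ?thesis
  proof cases
    case 1
    have "((\<lambda>x. x\<^sup>2) has_real_derivative 2 * x) (at x)" by (auto intro!: derivative_eq_intros)
    then have "((\<lambda>x. (max 0 x)\<^sup>2) has_real_derivative 2 * x) (at x)"
      by (rule has_field_derivative_transform_within_open[of _ _ _ "{0<..}"]) (use 1 in auto)
    then show ?thesis using 1 by simp
  next
    case 2
    have "((\<lambda>x. (max 0 x)\<^sup>2) has_real_derivative 0) (at x)"
      by (rule has_field_derivative_transform_within_open[OF DERIV_const[of 0], of "{..<0}"]) (use 2 in auto)
    then show ?thesis using 2 by simp
  next
    case 3
    have "((\<lambda>h. (max 0 h)\<^sup>2 / h) \<longlongrightarrow> 0) (at (0::real))"
    proof (rule Lim_null_comparison)
      show "\<forall>\<^sub>F h in at 0. norm ((max 0 h)\<^sup>2 / h) \<le> \<bar>h\<bar>"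
        by (intro always_eventually) (auto simp: max_def power2_eq_square)
      show "((\<lambda>h. \<bar>h\<bar>) \<longlongrightarrow> 0) (at (0::real))" by (intro tendsto_eq_intros) auto
    qed
    then show ?thesis using 3 by (simp add: DERIV_def)
  qed
qed

text \<open>A \<open>C\<^sup>1\<close> step rising from 0 at \<open>\<epsilon>\<close> to 1 at \<open>2 \<epsilon>\<close>.\<close>

definition cutoff :: "real \<Rightarrow> real \<Rightarrow> real" where
  "cutoff \<epsilon> t = 1 - (max 0 (1 - (max 0 (t / \<epsilon> - 1))\<^sup>2))\<^sup>2"

definition cutoff_deriv :: "real \<Rightarrow> real \<Rightarrow> real" where
  "cutoff_deriv \<epsilon> t = 4 / \<epsilon> * max 0 (1 - (max 0 (t / \<epsilon> - 1))\<^sup>2) * max 0 (t / \<epsilon> - 1)"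

lemma DERIV_cutoff: "(cutoff \<epsilon> has_real_derivative cutoff_deriv \<epsilon> t) (at t)"
proof -
  have "((\<lambda>t. t / \<epsilon> - 1) has_real_derivative 1 / \<epsilon>) (at t)"
    using DERIV_diff[OF DERIV_cdivide[OF DERIV_ident, of \<epsilon> t] DERIV_const[of 1]] by simp
  from DERIV_chain2[OF DERIV_max_0_power2 this]
  have "((\<lambda>t. 1 - (max 0 (t / \<epsilon> - 1))\<^sup>2) has_real_derivative 0 - 2 * max 0 (t / \<epsilon> - 1) * (1 / \<epsilon>)) (at t)"
    by (intro DERIV_diff DERIV_const)
  from DERIV_chain2[OF DERIV_max_0_power2 this]
  have "((\<lambda>t. 1 - (max 0 (1 - (max 0 (t / \<epsilon> - 1))\<^sup>2))\<^sup>2) has_real_derivative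
      0 - 2 * max 0 (1 - (max 0 (t / \<epsilon> - 1))\<^sup>2) * (0 - 2 * max 0 (t / \<epsilon> - 1) * (1 / \<epsilon>))) (at t)"
    by (intro DERIV_diff DERIV_const)
  then show ?thesis
    unfolding cutoff_def[abs_def] cutoff_deriv_def by (rule DERIV_cong) (simp add: field_simps)
qed

lemma continuous_cutoff_deriv: "continuous_on A (cutoff_deriv \<epsilon>)"
  unfolding cutoff_deriv_def[abs_def] divide_inverse by (intro continuous_intros)

lemma continuous_cutoff: "continuous_on A (cutoff \<epsilon>)"
  by (rule DERIV_continuous_on[OF DERIV_subset[OF DERIV_cutoff]]) simp

lemma cutoff_deriv_nonneg: "\<epsilon> > 0 \<Longrightarrow> cutoff_deriv \<epsilon> t \<ge> 0"
  by (simp add: cutoff_deriv_def)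

lemma cutoff_low: "\<epsilon> > 0 \<Longrightarrow> t \<le> \<epsilon> \<Longrightarrow> cutoff \<epsilon> t = 0"
  and cutoff_deriv_low: "\<epsilon> > 0 \<Longrightarrow> t \<le> \<epsilon> \<Longrightarrow> cutoff_deriv \<epsilon> t = 0"
  by (simp_all add: cutoff_def cutoff_deriv_def max_absorb1 divide_le_eq)

lemma cutoff_deriv_high:
  assumes "\<epsilon> > 0" "t \<ge> 2 * \<epsilon>" shows "cutoff_deriv \<epsilon> t = 0"
proof -
  have "t / \<epsilon> - 1 \<ge> 1" using assms by (simp add: le_divide_eq)
  then have "(max 0 (t / \<epsilon> - 1))\<^sup>2 \<ge> 1" by simp
  then show ?thesis by (simp add: cutoff_deriv_def max_absorb1)
qed

lemma cutoff_deriv_pos: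
  assumes "\<epsilon> > 0" "\<epsilon> < t" "t < 2 * \<epsilon>" shows "cutoff_deriv \<epsilon> t > 0"
proof -
  have *: "0 < t / \<epsilon> - 1" "t / \<epsilon> - 1 < 1" using assms by (auto simp: field_simps)
  then have "(t / \<epsilon> - 1)\<^sup>2 < 1" by (simp add: abs_square_less_1)
  then show ?thesis using * assms by (simp add: cutoff_deriv_def max_absorb2)
qed

lemma cutoff_le_1: "cutoff \<epsilon> t \<le> 1"
  by (simp add: cutoff_def)

text \<open>This is \<open>cutoff\<close> in its rescaled argument; both its sign and its dependence
  on \<epsilon> reduce to comparing such arguments.\<close>

lemma smoothstep_mono:
  assumes "(a::real) \<le> b"
  shows "1 - (max 0 (1 - (max 0 a)\<^sup>2))\<^sup>2 \<le> 1 - (max 0 (1 - (max 0 b)\<^sup>2))\<^sup>2"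
proof -
  have "(max 0 a)\<^sup>2 \<le> (max 0 b)\<^sup>2" using assms by (intro power_mono) auto
  then have "(max 0 (1 - (max 0 b)\<^sup>2))\<^sup>2 \<le> (max 0 (1 - (max 0 a)\<^sup>2))\<^sup>2"
    by (intro power_mono max.mono) auto
  then show ?thesis by simp
qed

lemma cutoff_nonneg: "cutoff \<epsilon> t \<ge> 0"
  using smoothstep_mono[of "min (t / \<epsilon> - 1) 0" "t / \<epsilon> - 1"] by (simp add: cutoff_def)

lemma cutoff_antimono:
  assumes "0 < \<epsilon>" "\<epsilon> \<le> \<epsilon>'" "t \<ge> 0" shows "cutoff \<epsilon>' t \<le> cutoff \<epsilon> t"
  unfolding cutoff_def using assms by (intro smoothstep_mono diff_right_mono divide_left_mono) auto

lemma cutoff_pos: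
  assumes "\<epsilon> > 0" "t > \<epsilon>" shows "cutoff \<epsilon> t > 0"
proof -
  have "max 0 (t / \<epsilon> - 1) > 0" using assms by (simp add: less_max_iff_disj less_divide_eq)
  then have "(max 0 (t / \<epsilon> - 1))\<^sup>2 > 0" by (rule zero_less_power)
  then have "max 0 (1 - (max 0 (t / \<epsilon> - 1))\<^sup>2) < 1" by linarith
  then have "(max 0 (1 - (max 0 (t / \<epsilon> - 1))\<^sup>2))\<^sup>2 < 1" by (subst abs_square_less_1) auto
  then show ?thesis by (simp add: cutoff_def)
qed

section \<open>Cut-off integrals and the bound on the constant\<close>

context overdetermined_torsion
begin

definition bulk :: "real \<Rightarrow> ('a \<Rightarrow> real) \<Rightarrow> real" where
  "bulk \<epsilon> k = (LINT x|lborel. (if x \<in> \<Omega> then cutoff \<epsilon> (u x) * k x else 0))"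

text \<open>For \<open>k = g \<bullet> X\<close> this is, by the coarea formula, minus the outward
  flux of \<open>X\<close> through the level sets of \<open>u\<close>, averaged over levels between
  \<epsilon> and 2 \<epsilon>. It takes the place of a boundary integral.\<close>

definition layer :: "real \<Rightarrow> ('a \<Rightarrow> real) \<Rightarrow> real" where
  "layer \<epsilon> k = (LINT x|lborel. (if x \<in> \<Omega> then cutoff_deriv \<epsilon> (u x) * k x else 0))"

lemma u_cont_dom: "continuous_on \<Omega> u"
  and g_cont_dom: "continuous_on \<Omega> g"
  using u_cont g_cont continuous_on_subset closure_subset by blast+

lemma superlevel_compact:
  assumes "\<epsilon> > 0"
  shows "compact {x \<in> closure \<Omega>. \<epsilon> \<le> u x}" "{x \<in> closure \<Omega>. \<epsilon> \<le> u x} \<subseteq> \<Omega>"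
proof -
  have "closed {x \<in> closure \<Omega>. \<epsilon> \<le> u x}"
    by (intro continuous_on_closed_Collect_le u_cont continuous_on_const closed_closure)
  then show "compact {x \<in> closure \<Omega>. \<epsilon> \<le> u x}"
    using compact_Int_closed[OF compact_closure_dom, of "{x \<in> closure \<Omega>. \<epsilon> \<le> u x}"]
    by (simp add: Int_absorb1 subset_eq)
  show "{x \<in> closure \<Omega>. \<epsilon> \<le> u x} \<subseteq> \<Omega>"
    using assms dirichlet closure_dom_eq by force
qed

lemma cutoff_extension:
  assumes \<epsilon>: "\<epsilon> > 0" and w: "continuous_on UNIV w" "\<And>t. t \<le> \<epsilon> \<Longrightarrow> w t = (0::real)"
    and k: "continuous_on \<Omega> k"
  shows "continuous_on UNIV (\<lambda>x. if x \<in> \<Omega> then w (u x) * k x else 0)"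
    and "integrable lborel (\<lambda>x. if x \<in> \<Omega> then w (u x) * k x else 0)"
proof -
  have zero: "w (u x) * k x = 0" if "x \<in> \<Omega> - {x \<in> closure \<Omega>. \<epsilon> \<le> u x}" for x
  proof -
    have "x \<in> closure \<Omega>" using that closure_subset by blast
    then have "u x \<le> \<epsilon>" using that by simp
    then show ?thesis by (simp add: w(2))
  qed
  have "continuous_on \<Omega> (\<lambda>x. w (u x) * k x)"
    by (intro continuous_intros k continuous_on_compose2[OF w(1) u_cont_dom]) auto
  from continuous_on_zero_extension[OF open_dom superlevel_compact[OF \<epsilon>] this zero]
  show c: "continuous_on UNIV (\<lambda>x. if x \<in> \<Omega> then w (u x) * k x else 0)" .
  show "integrable lborel (\<lambda>x. if x \<in> \<Omega> then w (u x) * k x else 0)"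
    by (rule integrable_continuous_compact_support[OF c superlevel_compact(1)[OF \<epsilon>]]) (simp add: zero)
qed

lemma bulk_extension:
  assumes "\<epsilon> > 0" "continuous_on \<Omega> k"
  shows "continuous_on UNIV (\<lambda>x. if x \<in> \<Omega> then cutoff \<epsilon> (u x) * k x else 0)"
    and "integrable lborel (\<lambda>x. if x \<in> \<Omega> then cutoff \<epsilon> (u x) * k x else 0)"
  by (rule cutoff_extension[OF assms(1) continuous_cutoff _ assms(2)], rule cutoff_low[OF assms(1)], assumption)+

lemma layer_extension:
  assumes "\<epsilon> > 0" "continuous_on \<Omega> k"
  shows "continuous_on UNIV (\<lambda>x. if x \<in> \<Omega> then cutoff_deriv \<epsilon> (u x) * k x else 0)"
    and "integrable lborel (\<lambda>x. if x \<in> \<Omega> then cutoff_deriv \<epsilon> (u x) * k x else 0)"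
  by (rule cutoff_extension[OF assms(1) continuous_cutoff_deriv _ assms(2)], rule cutoff_deriv_low[OF assms(1)], assumption)+

lemma bulk_scale: "bulk \<epsilon> (\<lambda>x. a * k x) = a * bulk \<epsilon> k"
proof -
  have "(\<lambda>x. if x \<in> \<Omega> then cutoff \<epsilon> (u x) * (a * k x) else 0)
      = (\<lambda>x. a * (if x \<in> \<Omega> then cutoff \<epsilon> (u x) * k x else 0))" by auto
  then show ?thesis by (simp add: bulk_def)
qed

lemma layer_scale: "layer \<epsilon> (\<lambda>x. a * k x) = a * layer \<epsilon> k"
proof -
  have "(\<lambda>x. if x \<in> \<Omega> then cutoff_deriv \<epsilon> (u x) * (a * k x) else 0)
      = (\<lambda>x. a * (if x \<in> \<Omega> then cutoff_deriv \<epsilon> (u x) * k x else 0))" by auto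
  then show ?thesis by (simp add: layer_def)
qed

text \<open>The weight vanishes for \<open>u x \<ge> 2 * \<epsilon>\<close>, so the integrands are
  compared only near the boundary.\<close>

lemma layer_mono:
  assumes "\<epsilon> > 0" "continuous_on \<Omega> k" "continuous_on \<Omega> k'"
    and "\<And>x. x \<in> \<Omega> \<Longrightarrow> u x < 2 * \<epsilon> \<Longrightarrow> k x \<le> k' x"
  shows "layer \<epsilon> k \<le> layer \<epsilon> k'"
  unfolding layer_def
proof (rule integral_mono)
  fix x
  show "(if x \<in> \<Omega> then cutoff_deriv \<epsilon> (u x) * k x else 0) \<le> (if x \<in> \<Omega> then cutoff_deriv \<epsilon> (u x) * k' x else 0)"
  proof (cases "x \<in> \<Omega> \<and> u x < 2 * \<epsilon>")
    case True
    then show ?thesis by (simp add: mult_left_mono assms(4) cutoff_deriv_nonneg[OF assms(1)])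
  next
    case False
    then show ?thesis by (cases "x \<in> \<Omega>") (simp_all add: cutoff_deriv_high[OF assms(1)])
  qed
qed (intro layer_extension assms)+

text \<open>Lets a positive lower bound found at one fixed level survive while \<epsilon> is made
  small.\<close>

lemma bulk_mono:
  assumes "0 < \<epsilon>" "\<epsilon> \<le> \<epsilon>'" "continuous_on \<Omega> k" "\<And>x. x \<in> \<Omega> \<Longrightarrow> k x \<ge> 0"
  shows "bulk \<epsilon>' k \<le> bulk \<epsilon> k"
  unfolding bulk_def
proof (rule integral_mono)
  fix x
  show "(if x \<in> \<Omega> then cutoff \<epsilon>' (u x) * k x else 0) \<le> (if x \<in> \<Omega> then cutoff \<epsilon> (u x) * k x else 0)"
    by (cases "x \<in> \<Omega>")
      (simp_all add: mult_right_mono assms(4) cutoff_antimono[OF assms(1,2)] less_imp_le[OF u_pos])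
qed (intro bulk_extension assms less_le_trans[OF assms(1,2)])+

lemma bulk_pos:
  assumes "\<epsilon> > 0" "continuous_on \<Omega> k" "\<And>x. x \<in> \<Omega> \<Longrightarrow> k x \<ge> 0" "x0 \<in> \<Omega>" "k x0 > 0" "u x0 > \<epsilon>"
  shows "bulk \<epsilon> k > 0"
  unfolding bulk_def
  by (rule integral_continuous_pos[OF bulk_extension[OF assms(1,2)], of x0])
    (simp_all add: assms cutoff_nonneg cutoff_pos[OF assms(1,6)])

lemma layer_pos:
  assumes "\<epsilon> > 0" "continuous_on \<Omega> k" "\<And>x. x \<in> \<Omega> \<Longrightarrow> k x \<ge> 0" "x0 \<in> \<Omega>" "k x0 > 0"
    "\<epsilon> < u x0" "u x0 < 2 * \<epsilon>"
  shows "layer \<epsilon> k > 0"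
  unfolding layer_def
  by (rule integral_continuous_pos[OF layer_extension[OF assms(1,2)], of x0])
    (simp_all add: assms cutoff_deriv_nonneg[OF assms(1)] cutoff_deriv_pos[OF assms(1,6,7)])

lemma bulk_one_le: "\<epsilon> > 0 \<Longrightarrow> bulk \<epsilon> (\<lambda>x. 1) \<le> measure lborel \<Omega>"
proof -
  assume \<epsilon>: "\<epsilon> > 0"
  have "bulk \<epsilon> (\<lambda>x. 1) \<le> (LINT x|lborel. indicat_real \<Omega> x)"
    unfolding bulk_def
  proof (rule integral_mono)
    show "integrable lborel (\<lambda>x. if x \<in> \<Omega> then cutoff \<epsilon> (u x) * 1 else 0)"
      by (rule bulk_extension[OF \<epsilon>]) (auto intro: continuous_intros)
    show "integrable lborel (indicat_real \<Omega>)"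
      using emeasure_bounded_finite[OF bounded_dom] open_dom
      by (intro integrable_real_indicator) auto
  qed (auto simp: cutoff_le_1)
  then show ?thesis by simp
qed

text \<open>The field \<open>cutoff \<epsilon> (u x) *\<^sub>R X x\<close> vanishes off a compact
  superlevel set of \<open>u\<close>, so its divergence has integral 0; the product rule splits that
  integral into the two terms.\<close>

lemma divergence_cutoff:
  assumes \<epsilon>: "\<epsilon> > 0"
    and X: "\<And>x. x \<in> \<Omega> \<Longrightarrow> (X has_derivative X' x) (at x)"
    and X': "\<And>i. i \<in> Basis \<Longrightarrow> continuous_on \<Omega> (\<lambda>x. X' x i \<bullet> i)"
    and d: "\<And>x. x \<in> \<Omega> \<Longrightarrow> d x = (\<Sum>i\<in>Basis. X' x i \<bullet> i)"
  shows "layer \<epsilon> (\<lambda>x. g x \<bullet> X x) = - bulk \<epsilon> d"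
proof -
  let ?Y = "\<lambda>x. cutoff \<epsilon> (u x) *\<^sub>R X x"
  let ?Y' = "\<lambda>x h. cutoff \<epsilon> (u x) *\<^sub>R X' x h + (cutoff_deriv \<epsilon> (u x) * (g x \<bullet> h)) *\<^sub>R X x"
  have Xc: "continuous_on \<Omega> X"
    using X has_derivative_continuous continuous_at_imp_continuous_on by blast
  have dc: "continuous_on \<Omega> d"
    by (rule continuous_on_eq[of _ "\<lambda>x. \<Sum>i\<in>Basis. X' x i \<bullet> i"]) (auto intro!: continuous_intros X' simp: d)
  have "(LINT x|lborel. (if x \<in> \<Omega> then \<Sum>i\<in>Basis. ?Y' x i \<bullet> i else 0)) = 0"
  proof (rule integral_divergence_zero[OF open_dom superlevel_compact[OF \<epsilon>], of ?Y])
    fix x assume x: "x \<in> \<Omega>"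
    have "(cutoff \<epsilon> has_derivative (\<lambda>s. cutoff_deriv \<epsilon> (u x) * s)) (at (u x))"
      using DERIV_cutoff by (simp add: has_field_derivative_def)
    from has_derivative_compose[OF u_deriv[OF x] this]
    have "((\<lambda>x. cutoff \<epsilon> (u x)) has_derivative (\<lambda>h. cutoff_deriv \<epsilon> (u x) * (g x \<bullet> h))) (at x)" .
    then show "(?Y has_derivative ?Y' x) (at x)"
      by (rule has_derivative_scaleR) (rule X[OF x])
  next
    fix i :: 'a assume i: "i \<in> Basis"
    have "continuous_on \<Omega> (\<lambda>x. cutoff \<epsilon> (u x) * (X' x i \<bullet> i) + cutoff_deriv \<epsilon> (u x) * (g x \<bullet> i) * (X x \<bullet> i))"
      by (intro continuous_intros X' i g_cont_dom Xc
          continuous_on_compose2[OF continuous_cutoff u_cont_dom order_refl]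
          continuous_on_compose2[OF continuous_cutoff_deriv u_cont_dom order_refl])
    then show "continuous_on \<Omega> (\<lambda>x. ?Y' x i \<bullet> i)" by (simp add: inner_add_left)
  next
    fix x assume "x \<in> \<Omega> - {x \<in> closure \<Omega>. \<epsilon> \<le> u x}"
    moreover from this have "x \<in> closure \<Omega>" using closure_subset by blast
    ultimately have "u x \<le> \<epsilon>" by simp
    then show "?Y x = 0" by (simp add: cutoff_low \<epsilon>)
  qed
  moreover have "(\<Sum>i\<in>Basis. ?Y' x i \<bullet> i) = cutoff_deriv \<epsilon> (u x) * (g x \<bullet> X x) + cutoff \<epsilon> (u x) * d x"
    if "x \<in> \<Omega>" for x
    using that by (simp add: d inner_add_left sum.distrib sum_distrib_left
        euclidean_inner[of "g x" "X x"] mult.assoc add.commute)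
  then have "(\<lambda>x. if x \<in> \<Omega> then \<Sum>i\<in>Basis. ?Y' x i \<bullet> i else 0) =
    (\<lambda>x. (if x \<in> \<Omega> then cutoff_deriv \<epsilon> (u x) * (g x \<bullet> X x) else 0) + (if x \<in> \<Omega> then cutoff \<epsilon> (u x) * d x else 0))"
    by auto
  moreover have "continuous_on \<Omega> (\<lambda>x. g x \<bullet> X x)" by (intro continuous_intros g_cont_dom Xc)
  note Bochner_Integration.integral_add[OF layer_extension(2)[OF \<epsilon> this] bulk_extension(2)[OF \<epsilon> dc]]
  ultimately have "layer \<epsilon> (\<lambda>x. g x \<bullet> X x) + bulk \<epsilon> d = 0"
    unfolding layer_def bulk_def by (simp only:)
  then show ?thesis by linarith
qed

text \<open>The set where \<open>q\<close> is nonnegative is compact inside \<Omega>, so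
  \<open>u\<close> has a positive minimum on it, and any smaller value of \<open>u\<close> forces
  \<open>q\<close> to be negative.\<close>

lemma near_boundary:
  assumes q: "continuous_on (closure \<Omega>) q" "\<And>p. p \<in> frontier \<Omega> \<Longrightarrow> q p < (0::real)"
  obtains \<epsilon>0 where "\<epsilon>0 > 0" "\<And>x. x \<in> \<Omega> \<Longrightarrow> u x < \<epsilon>0 \<Longrightarrow> q x < 0"
proof -
  let ?K = "{x \<in> closure \<Omega>. 0 \<le> q x}"
  have "closed ?K"
    by (intro continuous_on_closed_Collect_le q continuous_on_const closed_closure)
  then have K: "compact ?K"
    using compact_Int_closed[OF compact_closure_dom, of ?K] by (simp add: Int_absorb1 subset_eq)
  have sub: "?K \<subseteq> \<Omega>" using q(2) closure_dom_eq by force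
  show thesis
  proof (cases "?K = {}")
    case True
    have "q x < 0" if "x \<in> \<Omega>" for x
      using True subsetD[OF closure_subset that] by (metis (mono_tags, lifting) empty_iff mem_Collect_eq not_le)
    then show thesis using that[of 1] by simp
  next
    case False
    have "continuous_on ?K u" using u_cont by (rule continuous_on_subset) auto
    from continuous_attains_inf[OF K False this]
    obtain y where y: "y \<in> ?K" "\<And>x. x \<in> ?K \<Longrightarrow> u y \<le> u x" by blast
    show thesis
    proof (rule that[of "u y"])
      show "u y > 0" using y(1) sub u_pos by blast
      fix x assume "x \<in> \<Omega>" "u x < u y"
      then show "q x < 0" using y(2)[of x] subsetD[OF closure_subset, of x \<Omega>] by fastforce
    qed
  qed
qed

text \<open>The case of the gradient field. It makes the squared gradient the reference against
  which other layer integrals are measured.\<close>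

lemma layer_gradient: "\<epsilon> > 0 \<Longrightarrow> layer \<epsilon> (\<lambda>x. g x \<bullet> g x) = bulk \<epsilon> (\<lambda>x. 1)"
proof -
  assume \<epsilon>: "\<epsilon> > 0"
  have "layer \<epsilon> (\<lambda>x. g x \<bullet> g x) = - bulk \<epsilon> (\<lambda>x. - 1)"
  proof (rule divergence_cutoff[OF \<epsilon> g_deriv])
    show "- 1 = (\<Sum>i\<in>Basis. H x i \<bullet> i)" if "x \<in> \<Omega>" for x
      using laplacian[OF that] by (simp add: laplacian_of_def)
  qed (auto intro!: continuous_intros H_cont)
  then show ?thesis using bulk_scale[of \<epsilon> "-1" "\<lambda>x. 1"] by simp
qed

lemma layer_position: "\<epsilon> > 0 \<Longrightarrow> layer \<epsilon> (\<lambda>x. g x \<bullet> x) = - real DIM('a) * bulk \<epsilon> (\<lambda>x. 1)"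
proof -
  assume \<epsilon>: "\<epsilon> > 0"
  have "layer \<epsilon> (\<lambda>x. g x \<bullet> x) = - bulk \<epsilon> (\<lambda>x. real DIM('a) * 1)"
    by (rule divergence_cutoff[of \<epsilon> "\<lambda>x. x" "\<lambda>x h. h"]) (auto intro: \<epsilon> continuous_intros)
  then show ?thesis unfolding bulk_scale by simp
qed

text \<open>Near the boundary \<open>norm x\<close> is about \<open>norm (g x) / (- c)\<close>, so
  by Cauchy-Schwarz the layer integral of \<open>g x \<bullet> x\<close> is bounded below by about
  \<open>1 / c\<close> times that of the squared gradient. The divergence formula turns these into
  \<open>- real DIM('a)\<close> and 1 times the same positive bulk integral.\<close>

lemma c_bound: "real DIM('a) * (- c) \<le> 1"
proof (rule ccontr)
  assume "\<not> ?thesis"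
  then have "1 / (- c) < real DIM('a)" using c_neg by (simp add: pos_divide_less_eq[of "- c"] del: divide_minus_right)
  \<comment> \<open>Taking \<open>K\<close> strictly between the two numbers gives the strict
    inequality on the frontier that \<open>near_boundary\<close> asks for, while still contradicting
    the comparison of integrals.\<close>
  then obtain K where K: "1 / (- c) < K" "K < real DIM('a)" using dense by blast
  have K1: "1 + K * c < 0"
    using K(1) c_neg by (simp add: pos_divide_less_eq[of "- c"] del: divide_minus_right)
  have q: "continuous_on (closure \<Omega>) (\<lambda>x. norm (g x) * norm x - K * (g x \<bullet> g x))"
    by (intro continuous_intros g_cont)
  have neg: "norm (g p) * norm p - K * (g p \<bullet> g p) < 0" if p: "p \<in> frontier \<Omega>" for p
  proof -
    have "norm (g p) * norm p - K * (g p \<bullet> g p) = (- c) * (norm p)\<^sup>2 * (1 + K * c)"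
      by (simp add: dot_square_norm norm_g_frontier[OF p] power2_eq_square algebra_simps)
    moreover have "(- c) * (norm p)\<^sup>2 > 0" using c_neg frontier_nonzero[OF p] by (intro mult_pos_pos) auto
    ultimately show ?thesis using K1 by (simp only: mult_pos_neg)
  qed
  obtain \<epsilon>0 where \<epsilon>0: "\<epsilon>0 > 0" "\<And>x. x \<in> \<Omega> \<Longrightarrow> u x < \<epsilon>0 \<Longrightarrow> norm (g x) * norm x - K * (g x \<bullet> g x) < 0"
    using near_boundary[OF q neg] by blast
  obtain x0 where x0: "x0 \<in> \<Omega>" using dom_nonempty by blast
  define \<epsilon> where "\<epsilon> = min \<epsilon>0 (u x0) / 2"
  have \<epsilon>: "\<epsilon> > 0" "2 * \<epsilon> \<le> \<epsilon>0" "\<epsilon> < u x0" using \<epsilon>0(1) u_pos[OF x0] by (auto simp: \<epsilon>_def)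
  have "- real DIM('a) * bulk \<epsilon> (\<lambda>x. 1) = layer \<epsilon> (\<lambda>x. g x \<bullet> x)" by (simp add: layer_position \<epsilon>)
  also have "layer \<epsilon> (\<lambda>x. g x \<bullet> x) \<ge> layer \<epsilon> (\<lambda>x. (- K) * (g x \<bullet> g x))"
  proof (rule layer_mono[OF \<epsilon>(1)])
    fix x assume x: "x \<in> \<Omega>" "u x < 2 * \<epsilon>"
    then have "norm (g x) * norm x \<le> K * (g x \<bullet> g x)" using \<epsilon>0(2)[of x] \<epsilon> by force
    then show "(- K) * (g x \<bullet> g x) \<le> g x \<bullet> x"
      using Cauchy_Schwarz_ineq2[of "g x" x] by simp
  qed (auto intro!: continuous_intros g_cont_dom)
  also have "layer \<epsilon> (\<lambda>x. (- K) * (g x \<bullet> g x)) = - K * bulk \<epsilon> (\<lambda>x. 1)"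
    unfolding layer_scale by (simp add: layer_gradient \<epsilon>)
  finally have "real DIM('a) * bulk \<epsilon> (\<lambda>x. 1) \<le> K * bulk \<epsilon> (\<lambda>x. 1)" by simp
  moreover have "bulk \<epsilon> (\<lambda>x. 1) > 0"
    by (rule bulk_pos[OF \<epsilon>(1) _ _ x0]) (use \<epsilon> in \<open>auto intro: continuous_intros\<close>)
  ultimately show False using K(2) by simp
qed

end

section \<open>The P-function\<close>

context overdetermined_torsion
begin

text \<open>The quotient belongs to the dilation by \<open>1 + t\<close> about \<open>b\<close>. By
  the mean value theorem it is a derivative at a nearby point, and uniform continuity of
  \<open>g\<close> on the closure makes the error uniform over \<open>K\<close>.\<close>

lemma dilation_quotient_uniform:
  assumes K: "compact K" "K \<subseteq> \<Omega>" and \<eta>: "\<eta> > 0"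
  obtains t where "t > 0" "\<And>x. x \<in> K \<Longrightarrow> x + t *\<^sub>R (x - b) \<in> \<Omega>"
    "\<And>x. x \<in> K \<Longrightarrow> \<bar>(u (x + t *\<^sub>R (x - b)) - u x) / t - g x \<bullet> (x - b)\<bar> \<le> \<eta>"
proof -
  have "compact ((\<lambda>x. x - b) ` K)"
    by (intro compact_continuous_image continuous_intros K)
  then obtain R where R: "R > 0" "\<And>x. x \<in> K \<Longrightarrow> norm (x - b) \<le> R"
    using compact_imp_bounded bounded_pos by (metis (no_types, lifting) imageI)
  obtain e where e: "e > 0" "(\<Union>x\<in>K. cball x e) \<subseteq> \<Omega>"
    using compact_subset_open_imp_cball_epsilon_subset[OF K(1) open_dom K(2)] by blast
  have "uniformly_continuous_on (closure \<Omega>) g"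
    by (rule compact_uniformly_continuous[OF g_cont compact_closure_dom])
  then obtain d where d: "d > 0"
    "\<And>x y. x \<in> closure \<Omega> \<Longrightarrow> y \<in> closure \<Omega> \<Longrightarrow> dist y x < d \<Longrightarrow> dist (g y) (g x) < \<eta> / R"
    unfolding uniformly_continuous_on_def using divide_pos_pos[OF \<eta> R(1)] by metis
  define t where "t = min e (d / 2) / R"
  have t: "t > 0" "t * R \<le> e" "t * R < d" using e(1) d(1) R(1) by (auto simp: t_def)
  have step: "norm (s *\<^sub>R (x - b)) \<le> t * R" if "x \<in> K" "0 \<le> s" "s \<le> t" for x s
    using mult_mono[OF that(3) R(2)[OF that(1)]] that t(1) by simp
  have inside: "x + s *\<^sub>R (x - b) \<in> \<Omega>" if "x \<in> K" "0 \<le> s" "s \<le> t" for x s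
  proof -
    have "x + s *\<^sub>R (x - b) \<in> cball x e"
      using step[OF that] t(2) by (simp add: dist_norm)
    then show ?thesis using e(2) that(1) by blast
  qed
  show thesis
  proof (rule that[OF t(1)])
    fix x assume x: "x \<in> K"
    show "x + t *\<^sub>R (x - b) \<in> \<Omega>" using inside[OF x, of t] t(1) by simp
    have "continuous_on {0..t} (\<lambda>s. u (x + s *\<^sub>R (x - b)))"
      by (intro continuous_on_compose2[OF u_cont_dom] continuous_intros) (use inside[OF x] in auto)
    then have "\<exists>s. 0 < s \<and> s < t \<and> u (x + t *\<^sub>R (x - b)) - u x = t * (g (x + s *\<^sub>R (x - b)) \<bullet> (x - b))"
      by (rule gradient_mean_value[OF t(1)]) (use u_deriv inside[OF x] in auto)
    then obtain s where s: "0 < s" "s < t"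
      "u (x + t *\<^sub>R (x - b)) - u x = t * (g (x + s *\<^sub>R (x - b)) \<bullet> (x - b))" by blast
    let ?y = "x + s *\<^sub>R (x - b)"
    have "dist ?y x < d" using step[OF x, of s] s t(3) by (simp add: dist_norm)
    moreover have "?y \<in> closure \<Omega>" "x \<in> closure \<Omega>"
      using inside[OF x, of s] s x K(2) closure_subset by auto
    ultimately have "norm (g ?y - g x) \<le> \<eta> / R" using d(2) by (metis dist_norm less_imp_le)
    then have "norm (g ?y - g x) * norm (x - b) \<le> \<eta> / R * R"
      using R(1) R(2)[OF x] \<eta> by (intro mult_mono) auto
    then have "\<bar>(g ?y - g x) \<bullet> (x - b)\<bar> \<le> \<eta>"
      using Cauchy_Schwarz_ineq2[of "g ?y - g x" "x - b"] R(1) by simp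
    then show "\<bar>(u (x + t *\<^sub>R (x - b)) - u x) / t - g x \<bullet> (x - b)\<bar> \<le> \<eta>"
      using s(3) t(1) by (simp add: inner_diff_left)
  qed
qed

lemma c_square_bound: "real DIM('a) * c\<^sup>2 \<le> 1 / real DIM('a)"
proof -
  have "(real DIM('a) * (- c))\<^sup>2 \<le> 1\<^sup>2"
    using c_bound c_neg by (intro power_mono mult_nonneg_nonneg) auto
  then show ?thesis by (simp add: power2_eq_square field_simps)
qed

lemma gradient_bound:
  assumes x1: "x1 \<in> \<Omega>" shows "g x1 \<bullet> g x1 \<le> c\<^sup>2 * (x1 \<bullet> x1)"
proof (rule ccontr)
  define N where "N = real DIM('a)"
  have N: "N > 0" by (simp add: N_def)
  define h where "h x = g x \<bullet> g x - c\<^sup>2 * (x \<bullet> x)" for x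
  define m where "m = h x1"
  assume "\<not> g x1 \<bullet> g x1 \<le> c\<^sup>2 * (x1 \<bullet> x1)"
  then have m: "m > 0" by (simp add: m_def h_def)
  have h_cont: "continuous_on (closure \<Omega>) h"
    unfolding h_def by (intro continuous_intros g_cont)
  have h0: "h p = 0" if "p \<in> frontier \<Omega>" for p
    using norm_g_frontier[OF that] by (simp add: h_def dot_square_norm power_mult_distrib)
  \<comment> \<open>The level \<open>m / 2\<close> keeps \<open>K\<close> off the frontier, where
    \<open>h\<close> is 0, and leaves room below the maximum for the approximation errors.\<close>
  define K where "K = {x \<in> closure \<Omega>. m / 2 \<le> h x}"
  have "closed K" unfolding K_def
    by (intro continuous_on_closed_Collect_le h_cont continuous_on_const closed_closure)
  then have K: "compact K"
    using compact_Int_closed[OF compact_closure_dom, of K] by (simp add: K_def Int_absorb1 subset_eq)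
  have K\<Omega>: "K \<subseteq> \<Omega>" using h0 m closure_dom_eq by (force simp: K_def)
  have x1K: "x1 \<in> K" using x1 m closure_subset by (auto simp: K_def m_def)
  have "continuous_on K h" using h_cont by (rule continuous_on_subset) (auto simp: K_def)
  from continuous_attains_sup[OF K _ this] x1K
  obtain y0 where y0: "y0 \<in> K" "\<And>x. x \<in> K \<Longrightarrow> h x \<le> h y0" by blast
  have hy0: "h y0 \<ge> m" using y0(2)[OF x1K] by (simp add: m_def)
  txt \<open>With \<open>v = \<nabla>u + x/n\<close>, the convex function \<open>|v|\<^sup>2\<close> of \<open>v\<close> lies above its tangent at \<open>v(y0) = a\<close>. This minorises \<open>h\<close> by \<open>k\<close>,
    which is linear in \<open>\<nabla>u\<close>, and the only derivative of \<open>u\<close> in \<open>k\<close> is the dilation derivative about \<open>b\<close>: replacing it by a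
    quotient gives a \<open>C\<^sup>2\<close> function \<open>f\<close> with positive Laplacian.\<close>
  define a where "a = g y0 + (1 / N) *\<^sub>R y0"
  \<comment> \<open>With this centre the term \<open>2 * (g x \<bullet> a)\<close> of the tangent
    plane is absorbed into the dilation derivative.\<close>
  define b where "b = N *\<^sub>R a"
  define \<beta> where "\<beta> = 1 / N\<^sup>2 + c\<^sup>2"
  define k where "k x = - (2 / N) * (g x \<bullet> (x - b)) + (2 / N) * (a \<bullet> x) - a \<bullet> a - \<beta> * (x \<bullet> x)" for x
  have hk: "h x - k x = (g x + (1 / N) *\<^sub>R x - a) \<bullet> (g x + (1 / N) *\<^sub>R x - a)" for x
  proof -
    have "(g x + (1 / N) *\<^sub>R x - a) \<bullet> (g x + (1 / N) *\<^sub>R x - a)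
        = g x \<bullet> g x + (x \<bullet> x) / N\<^sup>2 + a \<bullet> a + 2 / N * (g x \<bullet> x) - 2 * (g x \<bullet> a) - 2 / N * (a \<bullet> x)"
      by (simp add: inner_add_left inner_add_right inner_diff_left inner_diff_right
          inner_commute[of x "g x"] inner_commute[of a "g x"] inner_commute[of x a] power2_eq_square
          add_divide_distrib diff_divide_distrib)
    moreover have "2 / N * (g x \<bullet> (x - b)) = 2 / N * (g x \<bullet> x) - 2 * (g x \<bullet> a)"
      using N by (simp add: b_def inner_diff_right right_diff_distrib)
    ultimately show ?thesis
      by (simp add: h_def k_def \<beta>_def distrib_right)
  qed
  have k_le: "k x \<le> h x" for x using hk[of x] inner_ge_zero by (metis diff_ge_0_iff_ge)
  have k_eq: "k y0 = h y0" using hk[of y0] by (simp add: a_def)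
  \<comment> \<open>The quotient enters with factor \<open>2 / N\<close>, so this tolerance moves
    \<open>k\<close> by at most \<open>m / 8\<close>.\<close>
  have \<eta>: "N * m / 16 > 0" using N m by simp
  obtain t where t: "t > 0" and tin: "\<And>x. x \<in> K \<Longrightarrow> x + t *\<^sub>R (x - b) \<in> \<Omega>"
    and tq: "\<And>x. x \<in> K \<Longrightarrow> \<bar>(u (x + t *\<^sub>R (x - b)) - u x) / t - g x \<bullet> (x - b)\<bar> \<le> N * m / 16"
    using dilation_quotient_uniform[OF K K\<Omega> \<eta>, where b = b] by metis
  define A where "A = 2 / (N * t)"
  define P where "P x = x + t *\<^sub>R (x - b)" for x
  define f where "f x = - A * (u (P x) - u x) + (2 / N) * (a \<bullet> x) - a \<bullet> a - \<beta> * (x \<bullet> x)" for x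
  define G where "G x = - A *\<^sub>R ((1 + t) *\<^sub>R g (P x) - g x) + (2 / N) *\<^sub>R a - (2 * \<beta>) *\<^sub>R x" for x
  define G' where "G' x v = - A *\<^sub>R ((1 + t) *\<^sub>R H (P x) ((1 + t) *\<^sub>R v) - H x v) - (2 * \<beta>) *\<^sub>R v" for x v
  have fk: "\<bar>f x - k x\<bar> \<le> m / 8" if x: "x \<in> K" for x
  proof -
    have "f x - k x = - (2 / N) * ((u (P x) - u x) / t - g x \<bullet> (x - b))"
      using N t by (simp add: f_def k_def A_def field_simps)
    then have "\<bar>f x - k x\<bar> = (2 / N) * \<bar>(u (P x) - u x) / t - g x \<bullet> (x - b)\<bar>"
      using N by (simp only: abs_mult) simp
    also have "\<dots> \<le> (2 / N) * (N * m / 16)"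
      using N tq[OF x] by (intro mult_left_mono) (auto simp: P_def)
    finally show ?thesis using N by simp
  qed
  have Pd: "(P has_derivative (\<lambda>v. (1 + t) *\<^sub>R v)) (at x)" for x
    unfolding P_def[abs_def] by (auto intro!: derivative_eq_intros simp: algebra_simps)
  have fd: "(f has_derivative (\<lambda>v. G x \<bullet> v)) (at x)" if x: "x \<in> K" for x
  proof -
    have Px: "P x \<in> \<Omega>" and x\<Omega>: "x \<in> \<Omega>" using tin[OF x] K\<Omega> x by (auto simp: P_def)
    have uP: "((\<lambda>x. u (P x)) has_derivative (\<lambda>v. g (P x) \<bullet> ((1 + t) *\<^sub>R v))) (at x)"
      by (rule has_derivative_compose[OF Pd u_deriv[OF Px]])
    have "(f has_derivative (\<lambda>v. - A * (g (P x) \<bullet> ((1 + t) *\<^sub>R v) - g x \<bullet> v) + (2 / N) * (a \<bullet> v) - 0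
        - \<beta> * (x \<bullet> v + v \<bullet> x))) (at x)"
      unfolding f_def[abs_def]
      by (intro has_derivative_add has_derivative_diff has_derivative_mult_right has_derivative_const
          has_derivative_inner has_derivative_inner_right has_derivative_ident uP u_deriv x\<Omega>)
    then show ?thesis
      by (rule has_derivative_eq_rhs)
        (simp add: G_def fun_eq_iff inner_add_left inner_diff_left inner_commute algebra_simps)
  qed
  have Gd: "(G has_derivative G' x) (at x)" if x: "x \<in> K" for x
  proof -
    have Px: "P x \<in> \<Omega>" and x\<Omega>: "x \<in> \<Omega>" using tin[OF x] K\<Omega> x by (auto simp: P_def)
    have gP: "((\<lambda>x. g (P x)) has_derivative (\<lambda>v. H (P x) ((1 + t) *\<^sub>R v))) (at x)"
      by (rule has_derivative_compose[OF Pd g_deriv[OF Px]])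
    have "(G has_derivative (\<lambda>v. - A *\<^sub>R ((1 + t) *\<^sub>R H (P x) ((1 + t) *\<^sub>R v) - H x v) + 0 - (2 * \<beta>) *\<^sub>R v)) (at x)"
      unfolding G_def[abs_def]
      by (intro has_derivative_add has_derivative_diff has_derivative_scaleR_right has_derivative_const
          has_derivative_ident gP g_deriv x\<Omega>)
    then show ?thesis by (simp add: G'_def[abs_def])
  qed
  have lap: "laplacian_of G' x > 0" if x: "x \<in> K" for x
  proof -
    have Px: "P x \<in> \<Omega>" and x\<Omega>: "x \<in> \<Omega>" using tin[OF x] K\<Omega> x by (auto simp: P_def)
    have lin: "H (P x) ((1 + t) *\<^sub>R v) = (1 + t) *\<^sub>R H (P x) v" for v
      using linear_cmul[OF has_derivative_linear[OF g_deriv[OF Px]]] by blast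
    have "G' x i \<bullet> i = - A * ((1 + t) * (1 + t)) * (H (P x) i \<bullet> i) + A * (H x i \<bullet> i) - 2 * \<beta>"
      if "i \<in> Basis" for i
      unfolding G'_def lin using that by (simp add: inner_diff_left algebra_simps)
    then have "laplacian_of G' x
        = - A * ((1 + t) * (1 + t)) * laplacian_of H (P x) + A * laplacian_of H x - 2 * \<beta> * N"
      unfolding laplacian_of_def sum_distrib_left N_def by (simp add: sum.distrib sum_subtractf sum_negf)
    also have "\<dots> = A * ((1 + t) * (1 + t) - 1) - 2 * \<beta> * N"
      using laplacian[OF Px] laplacian[OF x\<Omega>] by (simp add: right_diff_distrib)
    \<comment> \<open>The second-order part of \<open>(1 + t)\<^sup>2\<close> leaves the surplus
      \<open>2 * t / N\<close>, so the Laplacian is strictly positive even when n|c| = 1.\<close>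
    also have "\<dots> = 2 / N * (2 + t) - 2 * (1 / N + N * c\<^sup>2)"
      using N t by (simp add: A_def \<beta>_def field_simps power2_eq_square)
    also have "\<dots> = 2 * (1 / N - N * c\<^sup>2) + 2 * t / N"
      using N by (simp add: field_simps)
    also have "\<dots> > 0"
      using c_square_bound N t by (intro add_nonneg_pos) (auto simp: N_def)
    finally show ?thesis .
  qed
  have "continuous_on K f"
    using fd has_derivative_continuous continuous_at_imp_continuous_on by blast
  from continuous_attains_sup[OF K _ this] x1K
  obtain y where y: "y \<in> K" "\<And>x. x \<in> K \<Longrightarrow> f x \<le> f y" by blast
  define B where "B = {x \<in> \<Omega>. m / 2 < h x}"
  have BK: "B \<subseteq> K" using closure_subset by (auto simp: B_def K_def)
  have "open (\<Omega> \<inter> h -` {m / 2<..})"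
    by (rule continuous_open_preimage[OF continuous_on_subset[OF h_cont closure_subset] open_dom open_greaterThan])
  moreover have "\<Omega> \<inter> h -` {m / 2<..} = B" by (auto simp: B_def)
  ultimately have "open B" by simp
  \<comment> \<open>Off \<open>B\<close> one has \<open>f \<le> 5 * m / 8\<close>, whereas
    \<open>f y0 \<ge> 7 * m / 8\<close>; the maximum of \<open>f\<close> over \<open>K\<close> thus
    lies in the open set \<open>B\<close>.\<close>
  moreover have "y \<in> B"
  proof (rule ccontr)
    assume "y \<notin> B"
    then have "h y \<le> m / 2" using y(1) K\<Omega> by (auto simp: B_def)
    then have "f y \<le> m / 2 + m / 8" using fk[OF y(1)] k_le[of y] by linarith
    moreover have "f y \<ge> m - m / 8" using y(2)[OF y0(1)] fk[OF y0(1)] k_eq hy0 by linarith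
    ultimately show False using m by linarith
  qed
  ultimately have "laplacian_of G' y \<le> 0"
    by (rule laplacian_nonpos_at_max[where f = f and G = G]) (use BK y fd Gd in auto)
  then show False using lap[OF y(1)] by linarith
qed

text \<open>If \<open>k\<close> were positive at \<open>x0\<close>, its bulk integral would stay
  above a fixed positive number as \<epsilon> decreases. By the divergence formula it is
  proportional to a layer integral of \<open>g x \<bullet> X x\<close>, which vanishes on the
  boundary and so is below any multiple \<delta> of the squared gradient near it.\<close>

lemma gradient_eq:
  assumes x0: "x0 \<in> \<Omega>" shows "g x0 \<bullet> g x0 = c\<^sup>2 * (x0 \<bullet> x0)"
proof (rule ccontr)
  assume ne: "\<not> ?thesis"
  define N where "N = real DIM('a)"
  have N: "N > 0" by (simp add: N_def)
  define k where "k x = c\<^sup>2 * (x \<bullet> x) - g x \<bullet> g x" for x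
  have k_nonneg: "k x \<ge> 0" if "x \<in> \<Omega>" for x using gradient_bound[OF that] by (simp add: k_def)
  have k_pos: "k x0 > 0" using k_nonneg[OF x0] ne by (auto simp: k_def)
  have k_cont: "continuous_on \<Omega> k" unfolding k_def by (intro continuous_intros g_cont_dom)
  txt \<open>\<open>X\<close> is the Pohozaev field plus \<open>n u \<nabla>u - c\<^sup>2|x|\<^sup>2x/2\<close>: its divergence is \<open>(1 + n/2) h\<close> and its normal component vanishes
    on the boundary.\<close>
  define \<alpha> where "\<alpha> x = x \<bullet> g x + N * u x" for x
  define \<gamma> where "\<gamma> x = u x - 1 / 2 * (g x \<bullet> g x) - c\<^sup>2 / 2 * (x \<bullet> x)" for x
  define X where "X x = \<alpha> x *\<^sub>R g x + \<gamma> x *\<^sub>R x" for x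
  define X' where "X' x v = (\<alpha> x *\<^sub>R H x v + (v \<bullet> g x + x \<bullet> H x v + N * (g x \<bullet> v)) *\<^sub>R g x)
      + (\<gamma> x *\<^sub>R v + (g x \<bullet> v - g x \<bullet> H x v - c\<^sup>2 * (x \<bullet> v)) *\<^sub>R x)" for x v
  have X_deriv: "(X has_derivative X' x) (at x)" if x: "x \<in> \<Omega>" for x
  proof -
    have "(\<alpha> has_derivative (\<lambda>v. (x \<bullet> H x v + v \<bullet> g x) + N * (g x \<bullet> v))) (at x)"
      unfolding \<alpha>_def[abs_def]
      by (intro has_derivative_add has_derivative_inner has_derivative_ident g_deriv u_deriv
          has_derivative_mult_right x)
    then have \<alpha>d: "(\<alpha> has_derivative (\<lambda>v. v \<bullet> g x + x \<bullet> H x v + N * (g x \<bullet> v))) (at x)"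
      by (rule has_derivative_eq_rhs) (simp add: fun_eq_iff)
    have "(\<gamma> has_derivative (\<lambda>v. g x \<bullet> v - 1 / 2 * (g x \<bullet> H x v + H x v \<bullet> g x)
        - c\<^sup>2 / 2 * (x \<bullet> v + v \<bullet> x))) (at x)"
      unfolding \<gamma>_def[abs_def]
      by (intro has_derivative_diff has_derivative_inner has_derivative_ident g_deriv u_deriv
          has_derivative_mult_right x)
    then have \<gamma>d: "(\<gamma> has_derivative (\<lambda>v. g x \<bullet> v - g x \<bullet> H x v - c\<^sup>2 * (x \<bullet> v))) (at x)"
      by (rule has_derivative_eq_rhs) (simp add: fun_eq_iff inner_commute)
    show ?thesis
      unfolding X_def[abs_def] X'_def[abs_def]
      by (intro has_derivative_add has_derivative_scaleR \<alpha>d \<gamma>d g_deriv has_derivative_ident x)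
  qed
  have \<alpha>_cont: "continuous_on (closure \<Omega>) \<alpha>" and \<gamma>_cont: "continuous_on (closure \<Omega>) \<gamma>"
    unfolding \<alpha>_def \<gamma>_def by (auto intro!: continuous_intros g_cont u_cont)
  have dom: "continuous_on \<Omega> q" if "continuous_on (closure \<Omega>) q" for q :: "'a \<Rightarrow> real"
    using that closure_subset by (rule continuous_on_subset)
  have X'_cont: "continuous_on \<Omega> (\<lambda>x. X' x i \<bullet> i)" if "i \<in> Basis" for i
    unfolding X'_def
    by (intro continuous_intros g_cont_dom H_cont[OF that] dom[OF \<alpha>_cont] dom[OF \<gamma>_cont])
  have div: "- ((1 + N / 2) * k x) = (\<Sum>i\<in>Basis. X' x i \<bullet> i)" if x: "x \<in> \<Omega>" for x
  proof -
    \<comment> \<open>Symmetry of the Hessian makes the two second-order terms \<open>S1\<close> and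
      \<open>S2\<close> equal, so they cancel in the divergence.\<close>
    have H_inner: "y \<bullet> H x i = H x y \<bullet> i" for y i
      using H_symmetric[OF x, of i y] by (simp add: inner_commute)
    have S1: "(\<Sum>i\<in>Basis. (x \<bullet> H x i) * (g x \<bullet> i)) = H x x \<bullet> g x"
      unfolding H_inner by (rule euclidean_inner[symmetric])
    have "(\<Sum>i\<in>Basis. (g x \<bullet> H x i) * (x \<bullet> i)) = H x (g x) \<bullet> x"
      unfolding H_inner by (rule euclidean_inner[symmetric])
    then have S2: "(\<Sum>i\<in>Basis. (g x \<bullet> H x i) * (x \<bullet> i)) = H x x \<bullet> g x"
      using H_symmetric[OF x] by metis
    have S3: "(\<Sum>i\<in>Basis. H x i \<bullet> i) = - 1"
      using laplacian[OF x] by (simp add: laplacian_of_def)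
    have S4: "(\<Sum>i\<in>Basis. (y \<bullet> i) * (z \<bullet> i)) = y \<bullet> z" for y z :: 'a
      by (rule euclidean_inner[symmetric])
    have S5: "(\<Sum>i\<in>(Basis::'a set). i \<bullet> i) = N" by (simp add: N_def)
    have "(\<Sum>i\<in>Basis. X' x i \<bullet> i) = (\<Sum>i\<in>Basis. \<alpha> x * (H x i \<bullet> i) + (1 + N) * ((g x \<bullet> i) * (g x \<bullet> i))
        + (x \<bullet> H x i) * (g x \<bullet> i) + \<gamma> x * (i \<bullet> i) + (g x \<bullet> i) * (x \<bullet> i) - (g x \<bullet> H x i) * (x \<bullet> i)
        - c\<^sup>2 * ((x \<bullet> i) * (x \<bullet> i)))"
    proof (rule sum.cong[OF refl])
      fix i :: 'a
      show "X' x i \<bullet> i = \<alpha> x * (H x i \<bullet> i) + (1 + N) * ((g x \<bullet> i) * (g x \<bullet> i))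
        + (x \<bullet> H x i) * (g x \<bullet> i) + \<gamma> x * (i \<bullet> i) + (g x \<bullet> i) * (x \<bullet> i) - (g x \<bullet> H x i) * (x \<bullet> i)
        - c\<^sup>2 * ((x \<bullet> i) * (x \<bullet> i))"
        by (simp add: X'_def inner_add_left inner_commute[of i "g x"] algebra_simps)
    qed
    also have "\<dots> = - \<alpha> x + (1 + N) * (g x \<bullet> g x) + H x x \<bullet> g x + \<gamma> x * N + g x \<bullet> x - H x x \<bullet> g x
        - c\<^sup>2 * (x \<bullet> x)"
      unfolding sum.distrib sum_subtractf sum_distrib_left[symmetric] S1 S2 S3 S4 S5 by simp
    also have "\<dots> = - ((1 + N / 2) * k x)"
      by (simp add: \<alpha>_def \<gamma>_def k_def inner_commute[of "g x" x] field_simps)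
    finally show ?thesis by simp
  qed
  have gX: "g x \<bullet> X x = (x \<bullet> g x) * (u x - k x / 2) + N * u x * (g x \<bullet> g x)" for x
    by (simp add: X_def \<alpha>_def \<gamma>_def k_def inner_add_right inner_commute[of "g x" x] field_simps)
  define \<epsilon>1 where "\<epsilon>1 = u x0 / 2"
  have \<epsilon>1: "\<epsilon>1 > 0" "\<epsilon>1 < u x0" using u_pos[OF x0] by (auto simp: \<epsilon>1_def)
  define A where "A = (1 + N / 2) * bulk \<epsilon>1 k"
  have A: "A > 0"
    unfolding A_def using N bulk_pos[OF \<epsilon>1(1) k_cont k_nonneg x0 k_pos \<epsilon>1(2)] by simp
  define V where "V = measure lborel \<Omega>"
  have V: "V \<ge> 0" by (simp add: V_def)
  \<comment> \<open>Chosen so that \<open>\<delta> * V < A\<close>, where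
    \<open>\<delta> * V\<close> will bound the layer integral; the 1 keeps the denominator
    positive.\<close>
  define \<delta> where "\<delta> = A / (V + 1)"
  have \<delta>: "\<delta> > 0" "\<delta> * V < A" using A V by (auto simp: \<delta>_def field_simps)
  \<comment> \<open>Subtracting a multiple of the squared gradient, which is positive on the
    frontier, turns the boundary value 0 of \<open>g x \<bullet> X x\<close> into a strict
    sign.\<close>
  have q: "continuous_on (closure \<Omega>) (\<lambda>x. g x \<bullet> X x - \<delta> * (g x \<bullet> g x))"
    unfolding X_def by (intro continuous_intros g_cont \<alpha>_cont \<gamma>_cont)
  have neg: "g p \<bullet> X p - \<delta> * (g p \<bullet> g p) < 0" if p: "p \<in> frontier \<Omega>" for p
  proof -
    have gp: "g p \<bullet> g p = c\<^sup>2 * (p \<bullet> p)"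
      using norm_g_frontier[OF p] by (simp add: dot_square_norm power_mult_distrib)
    then have "g p \<bullet> X p = 0" by (simp add: gX dirichlet[OF p] k_def)
    moreover have "g p \<bullet> g p > 0" unfolding gp using c_neg frontier_nonzero[OF p] by simp
    ultimately show ?thesis using \<delta>(1) by simp
  qed
  obtain \<epsilon>0 where \<epsilon>0: "\<epsilon>0 > 0" "\<And>x. x \<in> \<Omega> \<Longrightarrow> u x < \<epsilon>0 \<Longrightarrow> g x \<bullet> X x - \<delta> * (g x \<bullet> g x) < 0"
    using near_boundary[OF q neg] by blast
  define \<epsilon> where "\<epsilon> = min (\<epsilon>0 / 2) \<epsilon>1"
  have \<epsilon>: "\<epsilon> > 0" "2 * \<epsilon> \<le> \<epsilon>0" "\<epsilon> \<le> \<epsilon>1" using \<epsilon>0(1) \<epsilon>1 by (auto simp: \<epsilon>_def)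
  have "A \<le> (1 + N / 2) * bulk \<epsilon> k"
    unfolding A_def using N by (intro mult_left_mono bulk_mono[OF \<epsilon>(1,3) k_cont k_nonneg]) auto
  also have "\<dots> = - bulk \<epsilon> (\<lambda>x. - ((1 + N / 2) * k x))"
    using bulk_scale[of \<epsilon> "- (1 + N / 2)" k] by (simp only: mult_minus_left minus_minus)
  also have "\<dots> = layer \<epsilon> (\<lambda>x. g x \<bullet> X x)"
    by (rule divergence_cutoff[OF \<epsilon>(1) X_deriv X'_cont div, symmetric])
  also have "\<dots> \<le> layer \<epsilon> (\<lambda>x. \<delta> * (g x \<bullet> g x))"
  proof (rule layer_mono[OF \<epsilon>(1)])
    show "continuous_on \<Omega> (\<lambda>x. g x \<bullet> X x)"
      unfolding X_def by (intro continuous_intros g_cont_dom dom[OF \<alpha>_cont] dom[OF \<gamma>_cont])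
    show "continuous_on \<Omega> (\<lambda>x. \<delta> * (g x \<bullet> g x))" by (intro continuous_intros g_cont_dom)
    show "g x \<bullet> X x \<le> \<delta> * (g x \<bullet> g x)" if "x \<in> \<Omega>" "u x < 2 * \<epsilon>" for x
      using \<epsilon>0(2)[OF that(1)] that(2) \<epsilon>(2) by linarith
  qed
  also have "\<dots> = \<delta> * bulk \<epsilon> (\<lambda>x. 1)" by (simp add: layer_scale layer_gradient[OF \<epsilon>(1)])
  also have "\<dots> \<le> \<delta> * V" using bulk_one_le[OF \<epsilon>(1)] \<delta>(1) by (simp add: V_def)
  finally show False using \<delta>(2) by linarith
qed

section \<open>Rigidity: identification of the constant, the gradient and the domain\<close>

lemma norm_gradient:
  assumes "x \<in> \<Omega>" shows "norm (g x) = - c * norm x"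
proof (rule power2_eq_imp_eq)
  show "(norm (g x))\<^sup>2 = (- c * norm x)\<^sup>2"
    using gradient_eq[OF assms] unfolding power_mult_distrib by (simp add: power2_norm_eq_inner)
  show "0 \<le> - c * norm x" using c_neg by (intro mult_nonneg_nonneg) auto
qed simp

text \<open>The maximum of \<open>u\<close> is interior, so the gradient vanishes there, and by
  \<open>norm_gradient\<close> that happens only at the origin.\<close>

lemma zero_in_dom: "0 \<in> \<Omega>"
proof -
  obtain x0 where x0: "x0 \<in> \<Omega>" using dom_nonempty by blast
  have "closure \<Omega> \<noteq> {}" using dom_nonempty by simp
  then obtain y where y: "y \<in> closure \<Omega>" "\<And>z. z \<in> closure \<Omega> \<Longrightarrow> u z \<le> u y"
    using continuous_attains_sup[OF compact_closure_dom _ u_cont] by blast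
  have "u y > 0" using u_pos[OF x0] y(2)[of x0] x0 closure_subset by force
  then have y\<Omega>: "y \<in> \<Omega>" using y(1) dirichlet closure_dom_eq by force
  have "(\<lambda>v. g y \<bullet> v) = (\<lambda>v. 0)"
    using differential_zero_maxmin[OF y\<Omega> open_dom u_deriv[OF y\<Omega>]] y(2) closure_subset by blast
  then have "g y = 0" by (metis inner_eq_zero_iff)
  then have "y = 0" using norm_gradient[OF y\<Omega>] c_neg by simp
  then show ?thesis using y\<Omega> by simp
qed

text \<open>Differentiating \<open>g\<close> at the origin, where it vanishes and its norm is
  \<open>- c * norm x\<close>, bounds each \<open>norm (H 0 i)\<close> by \<open>- c\<close>. Hence
  the trace -1 has absolute value at most n|c|, the converse of \<open>c_bound\<close>.\<close>

lemma c_eq: "c = - 1 / real DIM('a)"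
proof -
  define N where "N = real DIM('a)"
  have N: "N > 0" by (simp add: N_def)
  have lin: "linear (H 0)" using has_derivative_linear[OF g_deriv[OF zero_in_dom]] .
  have H0: "norm (H 0 i) \<le> - c + \<eta>" if i: "i \<in> Basis" and \<eta>: "\<eta> > 0" for i \<eta>
  proof -
    obtain d where d: "d > 0" "\<And>y. norm (y - 0) < d \<Longrightarrow> norm (g y - g 0 - H 0 (y - 0)) \<le> \<eta> * norm (y - 0)"
      using g_deriv[OF zero_in_dom] \<eta> unfolding has_derivative_at_alt by blast
    obtain d' where d': "d' > 0" "\<And>t. \<bar>t\<bar> < d' \<Longrightarrow> 0 + t *\<^sub>R i \<in> \<Omega>"
      using line_in_open[OF open_dom zero_in_dom, where e = i] by metis
    define t where "t = min d d' / 2"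
    have t: "t > 0" "t < d" "t < d'" using d(1) d'(1) by (auto simp: t_def)
    have "norm (g (t *\<^sub>R i) - H 0 (t *\<^sub>R i)) \<le> \<eta> * t"
      using d(2)[of "t *\<^sub>R i"] t i norm_gradient[OF zero_in_dom] by simp
    moreover have "norm (g (t *\<^sub>R i)) = - c * t"
      using norm_gradient[of "t *\<^sub>R i"] d'(2)[of t] t i by simp
    moreover have "norm (H 0 (t *\<^sub>R i)) = t * norm (H 0 i)"
      using t(1) by (simp add: linear_cmul[OF lin])
    ultimately have "t * norm (H 0 i) \<le> t * (- c + \<eta>)"
      using norm_triangle_ineq2[of "H 0 (t *\<^sub>R i)" "g (t *\<^sub>R i)"]
      by (simp add: norm_minus_commute algebra_simps)
    then show ?thesis using t(1) by simp
  qed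
  have "1 \<le> N * (- c) + e" if e: "e > 0" for e
  proof -
    have "1 = \<bar>\<Sum>i\<in>Basis. H 0 i \<bullet> i\<bar>"
      using laplacian[OF zero_in_dom] by (simp add: laplacian_of_def)
    also have "\<dots> \<le> (\<Sum>i\<in>Basis. \<bar>H 0 i \<bullet> i\<bar>)" by (rule sum_abs)
    also have "\<dots> \<le> (\<Sum>i\<in>(Basis::'a set). - c + e / N)"
    proof (rule sum_mono)
      fix i :: 'a assume i: "i \<in> Basis"
      have "\<bar>H 0 i \<bullet> i\<bar> \<le> norm (H 0 i)" using Cauchy_Schwarz_ineq2[of "H 0 i" i] i by simp
      also have "\<dots> \<le> - c + e / N" using H0[OF i, of "e / N"] e N by simp
      finally show "\<bar>H 0 i \<bullet> i\<bar> \<le> - c + e / N" .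
    qed
    also have "\<dots> = N * (- c + e / N)" by (simp add: N_def)
    also have "\<dots> = N * (- c) + e" using N by (simp add: right_diff_distrib)
    finally show ?thesis .
  qed
  then have "1 \<le> N * (- c)" by (rule field_le_epsilon)
  then have "N * (- c) = 1" using c_bound by (simp add: N_def)
  then show ?thesis using N by (simp add: N_def[symmetric] field_simps)
qed

text \<open>With \<open>norm x = N * norm (g x)\<close>, Cauchy-Schwarz makes \<open>k\<close>
  nonnegative. The field \<open>N *\<^sub>R g x + x\<close> is divergence-free, so layer integrals
  of \<open>k\<close> vanish and \<open>k\<close> is 0; this equality case gives the field norm
  0.\<close>

lemma gradient_radial:
  assumes x0: "x0 \<in> \<Omega>" shows "g x0 = - (1 / real DIM('a)) *\<^sub>R x0"
proof -
  define N where "N = real DIM('a)"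
  have N: "N > 0" by (simp add: N_def)
  have ng: "norm x = N * norm (g x)" if "x \<in> \<Omega>" for x
    using norm_gradient[OF that] c_eq N by (simp add: N_def)
  define k where "k x = g x \<bullet> (N *\<^sub>R g x + x)" for x
  have k_nonneg: "k x \<ge> 0" if "x \<in> \<Omega>" for x
  proof -
    have "\<bar>g x \<bullet> x\<bar> \<le> N * (norm (g x) * norm (g x))"
      using Cauchy_Schwarz_ineq2[of "g x" x] ng[OF that] by (simp add: mult.left_commute)
    then show ?thesis by (simp add: k_def inner_add_right dot_square_norm power2_eq_square)
  qed
  have k_cont: "continuous_on \<Omega> k" unfolding k_def by (intro continuous_intros g_cont_dom)
  \<comment> \<open>Then \<open>u x0\<close> is the midpoint of the interval from \<epsilon> to
    \<open>2 * \<epsilon>\<close>, where the layer weight is positive.\<close>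
  define \<epsilon> where "\<epsilon> = 2 * u x0 / 3"
  have \<epsilon>: "\<epsilon> > 0" "\<epsilon> < u x0" "u x0 < 2 * \<epsilon>" using u_pos[OF x0] by (auto simp: \<epsilon>_def)
  have "layer \<epsilon> (\<lambda>x. g x \<bullet> (N *\<^sub>R g x + x)) = - bulk \<epsilon> (\<lambda>x. 0)"
  proof (rule divergence_cutoff[OF \<epsilon>(1)])
    show "((\<lambda>x. N *\<^sub>R g x + x) has_derivative (\<lambda>v. N *\<^sub>R H x v + v)) (at x)" if "x \<in> \<Omega>" for x
      by (intro has_derivative_add has_derivative_scaleR_right g_deriv has_derivative_ident that)
    show "continuous_on \<Omega> (\<lambda>x. (N *\<^sub>R H x i + i) \<bullet> i)" if "i \<in> Basis" for i
      by (intro continuous_intros H_cont that)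
    show "0 = (\<Sum>i\<in>Basis. (N *\<^sub>R H x i + i) \<bullet> i)" if "x \<in> \<Omega>" for x
    proof -
      have "(\<Sum>i\<in>Basis. (N *\<^sub>R H x i + i) \<bullet> i) = N * laplacian_of H x + N"
        by (simp add: laplacian_of_def inner_add_left sum.distrib sum_distrib_left N_def)
      then show ?thesis using laplacian[OF that] by simp
    qed
  qed
  then have "layer \<epsilon> k = 0" using bulk_scale[of \<epsilon> 0 "\<lambda>x. 0"] by (simp add: k_def[abs_def])
  then have "\<not> k x0 > 0" using layer_pos[OF \<epsilon>(1) k_cont k_nonneg x0 _ \<epsilon>(2,3)] by force
  then have k0: "g x0 \<bullet> x0 = - N * (g x0 \<bullet> g x0)" using k_nonneg[OF x0] by (simp add: k_def inner_add_right)
  have x2: "x0 \<bullet> x0 = N\<^sup>2 * (g x0 \<bullet> g x0)"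
    using ng[OF x0] by (simp add: dot_square_norm power_mult_distrib)
  have "(N *\<^sub>R g x0 + x0) \<bullet> (N *\<^sub>R g x0 + x0) = N\<^sup>2 * (g x0 \<bullet> g x0) + 2 * N * (g x0 \<bullet> x0) + x0 \<bullet> x0"
    by (simp add: inner_add_left inner_add_right inner_commute[of x0 "g x0"] power2_eq_square distrib_left)
  also have "\<dots> = 0" unfolding k0 x2 by (simp add: power2_eq_square)
  finally have "N *\<^sub>R g x0 = - x0" by (simp add: eq_neg_iff_add_eq_0)
  then have "(1 / N) *\<^sub>R (N *\<^sub>R g x0) = (1 / N) *\<^sub>R (- x0)" by simp
  then show ?thesis using N by (simp add: N_def[symmetric])
qed

lemma solution_radial:
  "\<exists>R>0. \<Omega> = ball 0 R \<and> (\<forall>x\<in>closure \<Omega>. u x = - (1 / (2 * real DIM('a))) * ((norm x)\<^sup>2 - R\<^sup>2))"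
proof -
  define N where "N = real DIM('a)"
  have N: "N > 0" by (simp add: N_def)
  \<comment> \<open>By \<open>gradient_radial\<close> this function has zero gradient, so it is
    constant on the connected domain and, by continuity, on its closure.\<close>
  define w where "w x = u x + 1 / (2 * N) * ((x - 0) \<bullet> (x - 0))" for x :: 'a
  have "(w has_derivative (\<lambda>v. 0)) (at x)" if x: "x \<in> \<Omega>" for x
    unfolding w_def[abs_def]
    by (rule has_derivative_eq_rhs[OF has_derivative_add[OF u_deriv[OF x]
            has_derivative_mult_right[OF has_derivative_inner_self_diff]]])
      (simp add: fun_eq_iff gradient_radial[OF x] N_def)
  then have w\<Omega>: "w x = w 0" if "x \<in> \<Omega>" for x
    using has_derivative_zero_unique_connected[OF open_dom connected_dom _ that zero_in_dom] by blast
  have "continuous_on (closure \<Omega>) w" unfolding w_def by (intro continuous_intros u_cont)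
  then have w: "w x = w 0" if "x \<in> closure \<Omega>" for x
    using continuous_constant_on_closure[of \<Omega> w "w 0" x] w\<Omega> that by blast
  \<comment> \<open>Forced by the value at the origin, where the formula for \<open>u\<close> reads
    \<open>u 0 = R\<^sup>2 / (2 * N)\<close>.\<close>
  define R where "R = sqrt (2 * N * u 0)"
  have u0: "u 0 > 0" using u_pos[OF zero_in_dom] .
  have R: "R > 0" "R\<^sup>2 = 2 * N * u 0" using u0 N by (auto simp: R_def)
  have u_eq: "u x = - (1 / (2 * N)) * ((norm x)\<^sup>2 - R\<^sup>2)" if "x \<in> closure \<Omega>" for x
    using w[OF that] N by (simp add: w_def R(2) power2_norm_eq_inner field_simps)
  have lt: "norm x < R" if "x \<in> \<Omega>" for x
  proof -
    have "- (1 / (2 * N)) * ((norm x)\<^sup>2 - R\<^sup>2) > 0"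
      using u_pos[OF that] u_eq that closure_subset by force
    then have "(norm x)\<^sup>2 < R\<^sup>2" using N by (simp add: divide_less_0_iff)
    then show ?thesis using R(1) by (simp add: power2_less_imp_less)
  qed
  have fr: "norm x = R" if "x \<in> frontier \<Omega>" for x
  proof -
    have "x \<in> closure \<Omega>" using that closure_dom_eq by blast
    then have "(norm x)\<^sup>2 = R\<^sup>2" using u_eq dirichlet[OF that] N by simp
    then show ?thesis using R(1) by (simp add: power2_eq_iff_nonneg)
  qed
  have "\<Omega> = ball 0 R"
  proof
    show "\<Omega> \<subseteq> ball 0 R" using lt by auto
    \<comment> \<open>The frontier lies on the sphere of radius \<open>R\<close>, so the connected
      open ball, which meets the domain at the origin, cannot leave it.\<close>
    show "ball 0 R \<subseteq> \<Omega>"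
    proof (rule ccontr)
      assume "\<not> ball 0 R \<subseteq> \<Omega>"
      moreover have "0 \<in> ball 0 R \<inter> \<Omega>" using zero_in_dom R(1) by simp
      ultimately have "ball 0 R \<inter> frontier \<Omega> \<noteq> {}"
        by (intro connected_Int_frontier connected_ball) blast+
      then show False using fr by force
    qed
  qed
  then show ?thesis using R(1) u_eq unfolding N_def by blast
qed

end

theorem theorem5:
  fixes \<Omega> :: "'a::euclidean_space set"
    and u :: "'a \<Rightarrow> real" and g :: "'a \<Rightarrow> 'a" and H :: "'a \<Rightarrow> 'a \<Rightarrow> 'a"
    and c :: real
  assumes "DIM('a) \<ge> 2"
    and "bounded_domain \<Omega>"
    and "C2_boundary \<Omega>"
    and "C2_closure_with \<Omega> u g H"
    and "\<forall>x\<in>\<Omega>. laplacian_of H x = -1"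
    and "\<forall>x\<in>frontier \<Omega>. u x = 0"
    and "\<forall>x\<in>frontier \<Omega>. g x \<bullet> outward_normal \<Omega> x = c * norm x"
  shows "\<exists>R>0. \<Omega> = ball 0 R \<and> c = - 1 / real DIM('a) \<and>
           (\<forall>x\<in>closure \<Omega>. u x = - (1 / (2 * real DIM('a))) * ((norm x)\<^sup>2 - R\<^sup>2))"
proof -
  interpret overdetermined_torsion \<Omega> u g H c
    using assms by unfold_locales auto
  show ?thesis using solution_radial c_eq by blast
qed

end
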